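(* Let $n\in\mathbb{N}$. Then $$t(1,3,9,9;n)=\begin{cases} 0 & \text{if } 3\mid n-2,\\[2pt] \dfrac{4}{3}\displaystyle\sum_{d\mid 4n+11} d\left(\frac{3}{d}\right) & \text{if } 3\mid n,\\[2pt] 2\left(3^{\beta-1}\left(\dfrac{3}{n_1}\right)-1\right)\displaystyle\sum_{d\mid n_1} d\left(\frac{3}{d}\right) & \text{if } 3\mid n-1 \text{ and } 4n+11=3^\beta n_1 \text{ with } 3\nmid n_1,\end{cases}$$ where the sums are over positive divisors $d$.
   Context: $\mathbb{N}$ denotes the set of positive integers. For $a,b,c,d\in\mathbb{N}$ and an integer $m\ge0$, $t(a,b,c,d;m)$ is the number of $(x,y,z,w)\in\mathbb{Z}^4$ with $m = a\frac{x(x-1)}{2}+b\frac{y(y-1)}{2}+c\frac{z(z-1)}{2}+d\frac{w(w-1)}{2}$. $\left(\frac{a}{m}\right)$ denotes the Legendre–Jacobi–Kronecker symbol. *)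

theory Defs
  imports Complex_Main "HOL-Number_Theory.Number_Theory"
begin

text \<open>\<open>x * (x - 1)\<close> is always even, so the integer divisions below are exact.
  For positive \<open>a, b, c, d\<close> the set is finite, so that \<open>card\<close> really counts the representations.\<close>

definition t :: "nat \<Rightarrow> nat \<Rightarrow> nat \<Rightarrow> nat \<Rightarrow> nat \<Rightarrow> nat" where
  "t a b c d m = card {(x :: int, y :: int, z :: int, w :: int).
     int m = int a * (x * (x - 1) div 2) + int b * (y * (y - 1) div 2)
           + int c * (z * (z - 1) div 2) + int d * (w * (w - 1) div 2)}"

text \<open>The Legendre--Jacobi--Kronecker symbol \<open>(a / m)\<close> for arbitrary integers: it is completely
  multiplicative in \<open>m \<noteq> 0\<close>, equals the Legendre symbol at odd primes, and has the usual conventions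
  at \<open>m = 2\<close>, \<open>m = -1\<close> and \<open>m = 0\<close>.
  For negative \<open>m\<close> the factorization below is that of \<open>\<bar>m\<bar>\<close> into positive primes.\<close>

definition kronecker_prime :: "int \<Rightarrow> int \<Rightarrow> int" where
  "kronecker_prime a p =
     (if p = 2 then (if even a then 0 else if a mod 8 \<in> {1, 7} then 1 else -1)
      else Legendre a p)"

definition kronecker :: "int \<Rightarrow> int \<Rightarrow> int" where
  "kronecker a m =
     (if m = 0 then (if \<bar>a\<bar> = 1 then 1 else 0)
      else (if m < 0 \<and> a < 0 then -1 else 1) *
           (\<Prod>p\<in>#prime_factorization m. kronecker_prime a p))"

end

theory Submission
  imports Defs
begin

text \<open>
  Doubling and completing squares turns \<open>t(1,3,9,9;n)\<close> into the number of odd solutions of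
  \<open>x\<^sup>2 + 3y\<^sup>2 + 9z\<^sup>2 + 9w\<^sup>2 = 2(4n + 11)\<close>. Reduction modulo 3 relates this to the forms
  \<open>x\<^sup>2 + 3y\<^sup>2 + z\<^sup>2 + w\<^sup>2\<close> (count \<open>T\<^sub>1\<close>) and \<open>3x\<^sup>2 + y\<^sup>2 + 3z\<^sup>2 + 3w\<^sup>2\<close> (count \<open>T\<^sub>3\<close>).
  The central identity is, for \<open>N \<equiv> 3\<close> modulo 4,
  \<open>#{solutions of x\<^sup>2 + 3y\<^sup>2 + z\<^sup>2 + w\<^sup>2 = 2N, all odd, 3 not dividing x + z + w} = 4 \<Sum> \<chi>\<^sub>1\<^sub>2(d) N/d\<close>.
  Both the set of all solutions and the set of those with \<open>3 | x + z + w\<close> split into pairs of binary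
  forms of class number one, so their sizes are convolutions of \<open>\<Sum> \<chi>\<^sub>3(d)\<close> with \<open>\<Sum> \<chi>\<^sub>4(d)\<close>, and
  precisely this combination of convolutions is evaluated by Liouville's elementary method,
  applied to \<open>F(a,b) = \<chi>\<^sub>1\<^sub>2(a+b) + \<chi>\<^sub>1\<^sub>2(a+2b) - \<chi>\<^sub>1\<^sub>2(a+3b)\<close>. Sign changes and permutations of the
  variables modulo 3 then determine the proportion of solutions with \<open>3 | x + z + w\<close>, and give the
  recursion \<open>T\<^sub>3(9m) = T\<^sub>1(3m) = T\<^sub>3(m) + 16 \<Sum> \<chi>\<^sub>1\<^sub>2(d) m/d\<close>.
\<close>

section \<open>Representations by the norm forms of the Gaussian and Eisenstein integers\<close>

text \<open>The number of solutions of x^2 + 3y^2 + z^2 + w^2 = 2N is not reached by Liouville's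
  identity in isolation: the symmetrized summand carries a second product, supported on 4 | a and 3
  | b, and its convolution is the one that counts the solutions with 3 | x + z + w. Hence the
  central identity evaluates a difference, and each count must be recovered through a second linear
  relation, which comes from symmetries and depends on N modulo 3. The residue N = 3 modulo 4 is
  essential because it makes the divisor sum of \<open>chi4\<close> vanish, both at N and at N - c
  for 4 | c.

  Liouville's method yields the sum of \<open>chi12 d * (N div d)\<close>, which triples with N,
  whereas the theorem involves the sum of \<open>chi12 d * d\<close>. Passing to complementary
  divisors of n1 costs the factor \<open>chi12 n1\<close>; this is the origin of 3^(\<beta>-1)
  (3/n1). The summand -1 is the constant left when the increments 16 * 3^k = 2 * (3^(k+2) - 3^k) of
  the recursion telescope.\<close>

definition chi3 :: "int \<Rightarrow> int" where
  "chi3 a = (if a mod 3 = 1 then 1 else if a mod 3 = 2 then -1 else 0)"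

definition chi4 :: "int \<Rightarrow> int" where
  "chi4 a = (if a mod 4 = 1 then 1 else if a mod 4 = 3 then -1 else 0)"

lemma chi3_mult: "chi3 (a * b) = chi3 a * chi3 b"
proof -
  have m: "(a * b) mod 3 = ((a mod 3) * (b mod 3)) mod 3" by (simp add: mod_mult_eq)
  have "a mod 3 = 0 \<or> a mod 3 = 1 \<or> a mod 3 = 2" "b mod 3 = 0 \<or> b mod 3 = 1 \<or> b mod 3 = 2" by presburger+
  then show ?thesis unfolding chi3_def m by (elim disjE) simp_all
qed

lemma chi4_mult: "chi4 (a * b) = chi4 a * chi4 b"
proof -
  have m: "(a * b) mod 4 = ((a mod 4) * (b mod 4)) mod 4" by (simp add: mod_mult_eq)
  have "a mod 4 = 0 \<or> a mod 4 = 1 \<or> a mod 4 = 2 \<or> a mod 4 = 3" "b mod 4 = 0 \<or> b mod 4 = 1 \<or> b mod 4 = 2 \<or> b mod 4 = 3" by presburger+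
  then show ?thesis unfolding chi4_def m by (elim disjE) simp_all
qed

section \<open>Divisor sums of completely multiplicative functions\<close>

definition divisor_sum :: "(int \<Rightarrow> int) \<Rightarrow> int \<Rightarrow> int" where
  "divisor_sum f n = (\<Sum>d | 0 < d \<and> d dvd n. f d)"

lemma finite_pos_divisors [simp]: "n > 0 \<Longrightarrow> finite {d::int. 0 < d \<and> d dvd n}"
  by (rule finite_subset[of _ "{0..n}"]) (auto intro: zdvd_imp_le)

text \<open>The divisors of \<open>p * n\<close> are those of \<open>n\<close> together with
  \<open>p\<close> times those of \<open>n\<close>; the overlap consists of \<open>p\<close> times
  the divisors of \<open>n div p\<close>. The representation numbers obey the same recursion, and
  \<open>card_reps\<close> compares the two.\<close>

lemma divisor_sum_prime_mult:
  fixes f :: "int \<Rightarrow> int"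
  assumes f: "\<And>a b. f (a * b) = f a * f b" and p: "prime p" and n: "n > 0"
  shows "divisor_sum f (p * n) =
    (1 + f p) * divisor_sum f n - (if p dvd n then f p * divisor_sum f (n div p) else 0)"
proof -
  have p0: "p > 0" using p prime_gt_0_int by blast
  let ?D = "\<lambda>n. {d::int. 0 < d \<and> d dvd n}"
  have U: "?D (p * n) = ?D n \<union> (*) p ` ?D n"
  proof (intro equalityI subsetI)
    fix d assume d: "d \<in> ?D (p * n)"
    show "d \<in> ?D n \<union> (*) p ` ?D n"
    proof (cases "p dvd d")
      case True
      then obtain k where "d = p * k" by blast
      with d p0 show ?thesis by (auto simp: zero_less_mult_iff)
    next
      case False
      then have "coprime d p" using p by (metis coprime_commute prime_imp_coprime)
      with d show ?thesis by (auto simp: coprime_dvd_mult_right_iff)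
    qed
  qed (use p0 in auto)
  have scale: "(\<Sum>d\<in>(*) p ` ?D m. f d) = f p * divisor_sum f m" for m
    unfolding divisor_sum_def sum_distrib_left
    by (subst sum.reindex) (use p0 in \<open>auto simp: inj_on_def f\<close>)
  have "divisor_sum f (p * n) + (\<Sum>d\<in>?D n \<inter> (*) p ` ?D n. f d) = divisor_sum f n + f p * divisor_sum f n"
    unfolding scale[symmetric] unfolding divisor_sum_def U
    by (rule sum.union_inter) (use n in auto)
  moreover have "(\<Sum>d\<in>?D n \<inter> (*) p ` ?D n. f d) = (if p dvd n then f p * divisor_sum f (n div p) else 0)"
  proof (cases "p dvd n")
    case True
    then obtain m where m: "n = p * m" by blast
    then have "?D n \<inter> (*) p ` ?D n = (*) p ` ?D m" using p0 by (auto simp: zero_less_mult_iff)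
    with True m p0 show ?thesis by (simp add: scale)
  next
    case False
    then have "?D n \<inter> (*) p ` ?D n = {}" by auto
    with False show ?thesis by simp
  qed
  ultimately show ?thesis by (simp add: algebra_simps)
qed

section \<open>Norm forms at inert, ramified and split primes\<close>

definition reps :: "int \<Rightarrow> int \<Rightarrow> (int \<times> int) set" where
  "reps e n = {(x, y). x^2 + e * x * y + y^2 = n}"

lemma reps_bound:
  fixes x y e :: int
  assumes "e = 0 \<or> e = 1"
  shows "\<bar>x\<bar> \<le> 2 * (x^2 + e * x * y + y^2)" "\<bar>y\<bar> \<le> 2 * (x^2 + e * x * y + y^2)"
proof -
  have "0 \<le> (x + y)^2" by simp
  then have "x^2 + y^2 \<le> 2 * (x^2 + e * x * y + y^2)"
    using assms by (auto simp: power2_eq_square algebra_simps)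
  moreover have "\<bar>z\<bar> \<le> z^2" for z :: int
    using self_le_power[of "\<bar>z\<bar>" 2] by (cases "z = 0") auto
  moreover have "0 \<le> x^2" "0 \<le> y^2" by auto
  ultimately show "\<bar>x\<bar> \<le> 2 * (x^2 + e * x * y + y^2)" "\<bar>y\<bar> \<le> 2 * (x^2 + e * x * y + y^2)"
    by (smt (verit))+
qed

lemma finite_reps:
  assumes "e = 0 \<or> e = 1"
  shows "finite (reps e n)"
proof (rule finite_subset)
  show "reps e n \<subseteq> {-2*n..2*n} \<times> {-2*n..2*n}"
  proof
    fix z assume "z \<in> reps e n"
    then obtain x y where z: "z = (x, y)" "x^2 + e * x * y + y^2 = n" by (auto simp: reps_def)
    have "\<bar>x\<bar> \<le> 2 * n" "\<bar>y\<bar> \<le> 2 * n" using reps_bound[where x=x and y=y, OF assms] z by auto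
    then show "z \<in> {-2*n..2*n} \<times> {-2*n..2*n}" using z by auto
  qed
qed simp

lemma reps_scale:
  assumes "p \<noteq> (0::int)"
  shows "bij_betw (\<lambda>(x, y). (p * x, p * y)) (reps e n) {(x, y) \<in> reps e (p^2 * n). p dvd x \<and> p dvd y}"
proof (rule bij_betwI')
  fix z w assume "z \<in> reps e n" "w \<in> reps e n"
  show "((\<lambda>(x, y). (p * x, p * y)) z = (\<lambda>(x, y). (p * x, p * y)) w) = (z = w)"
    using assms by (auto split: prod.splits)
next
  fix z assume "z \<in> reps e n"
  then show "(\<lambda>(x, y). (p * x, p * y)) z \<in> {(x, y) \<in> reps e (p^2 * n). p dvd x \<and> p dvd y}"
    by (auto simp: reps_def power2_eq_square algebra_simps split: prod.splits)
next
  fix z assume "z \<in> {(x, y) \<in> reps e (p^2 * n). p dvd x \<and> p dvd y}"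
  then obtain u v where uv: "z = (u, v)" "u^2 + e * u * v + v^2 = p^2 * n" "p dvd u" "p dvd v"
    by (auto simp only: reps_def mem_Collect_eq split: prod.splits)
  obtain x y where xy: "u = p * x" "v = p * y" using uv(3,4) by (elim dvdE)
  have "p^2 * (x^2 + e * x * y + y^2) = u^2 + e * u * v + v^2" unfolding xy by (simp add: power2_eq_square algebra_simps)
  then have "p^2 * (x^2 + e * x * y + y^2) = p^2 * n" by (simp only: uv(2))
  then have "(x, y) \<in> reps e n" using assms by (simp add: reps_def)
  then show "\<exists>w\<in>reps e n. z = (\<lambda>(x, y). (p * x, p * y)) w" using uv xy by (intro bexI[of _ "(x,y)"]) auto
qed

text \<open>\<open>x\<^sup>2 + e x y + y\<^sup>2\<close> is the norm form of the Gaussian integers for \<open>e = 0\<close> and of the Eisenstein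
  integers for \<open>e = 1\<close>; \<open>norm_char e\<close> is the character of the corresponding quadratic field.\<close>

definition norm_char :: "int \<Rightarrow> int \<Rightarrow> int" where
  "norm_char e = (if e = 0 then chi4 else chi3)"

text \<open>Fermat's little theorem excludes solutions prime to \<open>p\<close>. For
  \<open>p = 4k + 3\<close>, raising x^2 = -y^2 to the odd power (p - 1)/2 gives 1 = -1. For
  \<open>p = 3k + 2\<close>, the form divides x^3 - y^3, and cubing is injective modulo
  \<open>p\<close>; so x = y, the form becomes 3x^2, and \<open>p\<close> would divide 3.\<close>

lemma reps_inert_dvd:
  assumes e: "e = 0 \<or> e = 1" and p: "prime p" and chi: "norm_char e p = -1"
    and dvd: "p dvd x^2 + e * x * y + y^2"
  shows "p dvd x \<and> p dvd y"
proof -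
  define q where "q = nat p"
  have q: "prime q" "p = int q" using p prime_gt_0_int[OF p] by (auto simp: q_def)
  have fermat: "[z ^ (q - 1) = 1] (mod p)" if "\<not> p dvd z" for z
  proof -
    define a where "a = nat (z mod p)"
    have a: "int a = z mod p" using q prime_gt_0_nat[of q] by (simp add: a_def)
    then have "\<not> int q dvd int a" using that q by (simp add: dvd_mod_iff)
    then have "[a ^ (q - 1) = 1] (mod q)" using fermat_theorem[of q a] q by simp
    then have "[int (a ^ (q - 1)) = int 1] (mod int q)" by (simp only: cong_int_iff)
    then have "[(z mod p) ^ (q - 1) = 1] (mod p)" by (simp only: of_nat_power a q(2)[symmetric] of_nat_1)
    then show ?thesis by (simp only: cong_def power_mod)
  qed
  have xy: "p dvd x" if "p dvd y"
  proof -
    have "(x^2 + e * x * y + y^2) - y * (e * x + y) = x^2" by (simp add: power2_eq_square algebra_simps)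
    moreover have "p dvd (x^2 + e * x * y + y^2) - y * (e * x + y)" by (rule dvd_diff[OF dvd dvd_mult2[OF that]])
    ultimately have "p dvd x^2" by (simp only:)
    then show ?thesis using p prime_dvd_power by blast
  qed
  have yx: "p dvd y" if "p dvd x"
  proof -
    have "(x^2 + e * x * y + y^2) - x * (x + e * y) = y^2" by (simp add: power2_eq_square algebra_simps)
    moreover have "p dvd (x^2 + e * x * y + y^2) - x * (x + e * y)" by (rule dvd_diff[OF dvd dvd_mult2[OF that]])
    ultimately have "p dvd y^2" by (simp only:)
    then show ?thesis using p prime_dvd_power by blast
  qed
  show ?thesis
  proof (rule ccontr)
    assume "\<not> ?thesis"
    with xy yx have nx: "\<not> p dvd x" and ny: "\<not> p dvd y" by auto
    from e show False
    proof
      assume e: "e = 0"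
      with chi have "p mod 4 = 3" by (auto simp: norm_char_def chi4_def split: if_splits)
      then have "q mod 4 = 3" using q by presburger
      then have "q = 4 * (q div 4) + 3" by presburger
      then obtain k where k: "q = 4 * k + 3" by blast
      have "x^2 - - (y^2) = x^2 + e * x * y + y^2" using e by simp
      then have "[x^2 = - (y^2)] (mod p)" unfolding cong_iff_dvd_diff using dvd by (simp only:)
      then have "[(x^2) ^ (2*k+1) = (- (y^2)) ^ (2*k+1)] (mod p)" by (rule cong_pow)
      moreover have "2 * (2*k+1) = q - 1" using k by simp
      moreover have "(x^2) ^ (2*k+1) = x ^ (2 * (2*k+1))" "(- (y^2)) ^ (2*k+1) = - (y ^ (2 * (2*k+1)))"
        by (metis power_mult) (metis power_mult power_minus_odd even_plus_one_iff dvd_triv_left)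
      ultimately have "[x ^ (q - 1) = - (y ^ (q - 1))] (mod p)" by metis
      then have "[1 = - 1] (mod p)"
        using fermat[OF nx] fermat[OF ny]
        by (meson cong_minus_minus_iff cong_sym cong_trans)
      then have "p dvd 2" by (simp add: cong_iff_dvd_diff)
      then show False using k q by (auto dest: zdvd_imp_le)
    next
      assume e: "e = 1"
      with chi have "p mod 3 = 2" by (auto simp: norm_char_def chi3_def split: if_splits)
      then have "q mod 3 = 2" using q by presburger
      then have "q = 3 * (q div 3) + 2" by presburger
      then obtain k where k: "q = 3 * k + 2" by blast
      have "x^3 - y^3 = (x - y) * (x^2 + e * x * y + y^2)" using e by (simp add: power2_eq_square power3_eq_cube algebra_simps)
      then have "[x^3 = y^3] (mod p)" unfolding cong_iff_dvd_diff using dvd by (simp only: dvd_mult)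
      then have "[(x^3)^k * x = (y^3)^k * x] (mod p)" by (rule cong_mult[OF cong_pow cong_refl])
      moreover have "(z^3)^k * z = z ^ (q - 1)" for z :: int using k power_mult[of z 3 k] by simp
      moreover have "[x ^ (q - 1) = y ^ (q - 1)] (mod p)" using fermat[OF nx] fermat[OF ny] cong_sym cong_trans by blast
      ultimately have "[(y^3)^k * y = (y^3)^k * x] (mod p)" by (metis cong_sym cong_trans)
      then have "p dvd (y^3)^k * (y - x)" unfolding cong_iff_dvd_diff by (simp only: right_diff_distrib)
      then have "p dvd y - x" using ny p by (meson prime_dvd_mult_iff prime_dvd_power)
      moreover have "x^2 + e * x * y + y^2 = 3 * x^2 + (y - x) * (y + 2 * x)" using e by (simp add: power2_eq_square algebra_simps)
      ultimately have "p dvd 3 * x^2" using dvd by (metis dvd_add_left_iff dvd_mult2)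
      then have "p dvd 3" using nx p by (meson prime_dvd_mult_iff prime_dvd_power)
      then have "p \<le> 3" by (rule zdvd_imp_le) simp
      then have "p = 2" using k q by auto
      with \<open>p dvd 3\<close> have False by simp
      then show False .
    qed
  qed
qed

lemma card_eq_witness:
  assumes "\<And>x. x \<in> A \<Longrightarrow> f x \<in> B \<and> g (f x) = x"
    and "\<And>y. y \<in> B \<Longrightarrow> g y \<in> A \<and> f (g y) = y"
  shows "card A = card B"
  by (rule bij_betw_same_card[of f], rule bij_betw_byWitness[where f' = g]) (use assms in auto)

lemma reps_inert:
  assumes e: "e = 0 \<or> e = 1" and p: "prime p" and chi: "norm_char e p = -1" and n: "n > 0"
  shows "card (reps e (p * n)) = (if p dvd n then card (reps e (n div p)) else 0)"
proof (cases "p dvd n")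
  case True
  then obtain m where m: "n = p * m" by blast
  have "p dvd x \<and> p dvd y" if "(x, y) \<in> reps e (p * n)" for x y
    by (rule reps_inert_dvd[OF e p chi]) (use that in \<open>simp add: reps_def\<close>)
  moreover have "p^2 * m = p * n" using m by (simp add: power2_eq_square)
  ultimately have "{(x, y) \<in> reps e (p^2 * m). p dvd x \<and> p dvd y} = reps e (p * n)" by auto
  then show ?thesis
    using bij_betw_same_card[OF reps_scale[of p e m]] True m p by auto
next
  case False
  have "False" if "(x, y) \<in> reps e (p * n)" for x y
  proof -
    have *: "x^2 + e * x * y + y^2 = p * n" using that by (simp add: reps_def)
    then obtain x' y' where "x = p * x'" "y = p * y'"
      using reps_inert_dvd[OF e p chi, of x y] by (auto simp: dvd_def)
    with * have "p * (p * (x'^2 + e * x' * y' + y'^2)) = p * n"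
      by (simp add: power2_eq_square algebra_simps)
    then have "n = p * (x'^2 + e * x' * y' + y'^2)" using p by auto
    with False show False by simp
  qed
  then have "reps e (p * n) = {}" by auto
  with False show ?thesis by simp
qed

text \<open>Multiplication by 1 + i, of norm 2. It can be undone because an even value of x^2 + y^2
  forces x and y to have equal parity.\<close>

lemma reps_two: "card (reps 0 (2 * n)) = card (reps 0 n)"
proof (rule card_eq_witness[symmetric, where f = "\<lambda>(x, y). (x - y, x + y)" and g = "\<lambda>(x, y). ((x + y) div 2, (y - x) div 2)"])
  fix z assume "z \<in> reps 0 (2 * n)"
  then obtain x y where z: "z = (x, y)" and *: "x^2 + y^2 = 2 * n" by (auto simp: reps_def)
  then have "even (x + y)" by (metis dvd_triv_left even_add even_power pos2)
  then obtain k where k: "y = 2 * k - x" by (metis add_diff_cancel_left' evenE)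
  have d: "(x + y) div 2 = k" "(y - x) div 2 = k - x" unfolding k by simp_all
  have "2 * (k^2 + (k - x)^2) = 2 * n" using * unfolding k by (simp add: power2_eq_square algebra_simps)
  then show "(case z of (x, y) \<Rightarrow> ((x + y) div 2, (y - x) div 2)) \<in> reps 0 n \<and>
      (case case z of (x, y) \<Rightarrow> ((x + y) div 2, (y - x) div 2) of (x, y) \<Rightarrow> (x - y, x + y)) = z"
    unfolding z by (simp add: d reps_def) (simp add: k)
qed (auto simp: reps_def power2_eq_square algebra_simps)

text \<open>Multiplication by 1 + \<theta>, of norm 3, where \<theta> is a primitive sixth root of
  unity and (x, y) stands for x + y\<theta>. It can be undone because the form is (y - x)^2 modulo
  3.\<close>

lemma reps_three: "card (reps 1 (3 * n)) = card (reps 1 n)"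
proof (rule card_eq_witness[symmetric, where f = "\<lambda>(x, y). (x - y, x + 2 * y)" and g = "\<lambda>(x, y). ((2 * x + y) div 3, (y - x) div 3)"])
  fix z assume "z \<in> reps 1 (3 * n)"
  then obtain x y where z: "z = (x, y)" and *: "x^2 + x * y + y^2 = 3 * n" by (auto simp: reps_def)
  then have "(y - x)^2 = 3 * (n - x * y)" by (simp add: power2_eq_square algebra_simps)
  then have "3 dvd (y - x)^2" by simp
  then have "3 dvd y - x" using prime_dvd_power[of "3::int"] by simp
  then obtain k where k: "y = 3 * k + x" by (metis diff_add_cancel dvdE)
  have d: "(2 * x + y) div 3 = x + k" "(y - x) div 3 = k" unfolding k by simp_all
  have "3 * ((x + k)^2 + (x + k) * k + k^2) = 3 * n"
    using * unfolding k by (simp add: power2_eq_square algebra_simps)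
  then show "(case z of (x, y) \<Rightarrow> ((2 * x + y) div 3, (y - x) div 3)) \<in> reps 1 n \<and>
      (case case z of (x, y) \<Rightarrow> ((2 * x + y) div 3, (y - x) div 3) of (x, y) \<Rightarrow> (x - y, x + 2 * y)) = z"
    unfolding z by (simp add: d reps_def) (simp add: k)
qed (auto simp: reps_def power2_eq_square algebra_simps)

text \<open>As \<open>p\<close> is 1 modulo 4 or modulo 3, some residue has exact order 4 or 3. It
  is a root of X^4 - 1 or X^3 - 1, and its order excludes the factor X^2 - 1 or X - 1, which leaves
  the required quadratic.\<close>

lemma prime_dvd_norm:
  assumes e: "e = 0 \<or> e = 1" and p: "prime p" and chi: "norm_char e p = 1"
  shows "\<exists>r. p dvd r^2 + e * r + 1"
proof -
  define q where "q = nat p"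
  have q: "prime q" "p = int q" using p prime_gt_0_int[OF p] by (auto simp: q_def)
  define k :: nat where "k = (if e = 0 then 4 else 3)"
  have "p mod int k = 1" using chi e by (auto simp: norm_char_def chi3_def chi4_def k_def split: if_splits)
  then have "int (q mod k) = int 1" using q by (simp only: of_nat_mod of_nat_1)
  then have "q mod k = 1" by (simp only: of_nat_eq_iff)
  then have "k dvd q - 1" using dvd_minus_mod[of k q] by simp
  have "card {x\<in>totatives q. ord q x = k} = (if k dvd q - 1 then totient k else 0)"
    using prime_card_elements_with_ord_eq_totient q(1) prime_gt_1_nat by blast
  then have "card {x\<in>totatives q. ord q x = k} \<noteq> 0" using \<open>k dvd q - 1\<close> by (simp add: k_def)
  then have "{x\<in>totatives q. ord q x = k} \<noteq> {}" by (metis card.empty)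
  then obtain x where x: "ord q x = k" by blast
  have pw: "p dvd int x ^ j - 1 \<longleftrightarrow> k dvd j" for j
  proof -
    have "p dvd int x ^ j - 1 \<longleftrightarrow> [int (x ^ j) = int 1] (mod int q)" by (simp add: cong_iff_dvd_diff q)
    also have "\<dots> \<longleftrightarrow> k dvd j" by (simp only: cong_int_iff ord_divides x)
    finally show ?thesis .
  qed
  from e show ?thesis
  proof
    assume e: "e = 0"
    have "p dvd (int x^2 - 1) * (int x^2 + 1)" using pw[of 4] e by (simp add: k_def algebra_simps power_numeral_reduce)
    moreover have "\<not> p dvd int x^2 - 1" using pw[of 2] e by (simp add: k_def)
    ultimately have "p dvd int x^2 + 1" using p prime_dvd_mult_iff by blast
    then show ?thesis using e by auto
  next
    assume e: "e = 1"
    have "p dvd (int x - 1) * (int x^2 + int x + 1)" using pw[of 3] e by (simp add: k_def algebra_simps power_numeral_reduce)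
    moreover have "\<not> p dvd int x - 1" using pw[of 1] e by (simp add: k_def)
    ultimately have "p dvd int x^2 + int x + 1" using p prime_dvd_mult_iff by blast
    then show ?thesis using e by auto
  qed
qed

text \<open>Thue's argument: more than \<open>p\<close> pairs in a square of side below sqrt p give
  a small nonzero (u, v) with u = r v modulo \<open>p\<close>, so the form takes a value
  \<open>p * m\<close> with 0 < m < 3, and even m < 2 for \<open>e = 0\<close>. For
  \<open>e = 1\<close>, \<open>m = 2\<close> would make u and v even, hence \<open>p = 2\<close>,
  which is inert.\<close>

lemma reps_split_exists:
  assumes e: "e = 0 \<or> e = 1" and p: "prime p" and chi: "norm_char e p = 1"
  shows "\<exists>u v. u^2 + e * u * v + v^2 = p"
proof -
  obtain r where r: "p dvd r^2 + e * r + 1" using prime_dvd_norm[OF assms] by blast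
  have p0: "p > 1" using p prime_gt_1_int by blast
  define k where "k = \<lfloor>sqrt (of_int p)\<rfloor>"
  have k0: "k \<ge> 0" using p0 by (simp add: k_def)
  have k1: "p < (k + 1)^2"
  proof -
    have "sqrt p < of_int (k + 1)" unfolding k_def by linarith
    then have "(sqrt p)^2 < (of_int (k + 1))^2" using p0 by (intro power_strict_mono) auto
    then have "of_int p < (of_int ((k + 1)^2) :: real)" using p0 by simp
    then show ?thesis by (simp only: of_int_less_iff)
  qed
  have k2: "k^2 < p"
  proof -
    have "of_int k \<le> sqrt p" unfolding k_def by linarith
    then have "(of_int k)^2 \<le> (sqrt p)^2" using k0 by (intro power_mono) auto
    then have "of_int (k^2) \<le> (of_int p :: real)" using p0 by simp
    then have "k^2 \<le> p" by (simp only: of_int_le_iff)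
    moreover have "k^2 \<noteq> p" using p prime_power_iff[of "k" 2] by auto
    ultimately show ?thesis by simp
  qed
  define f where "f = (\<lambda>(x, y). (x - r * y) mod p)"
  have "f ` ({0..k} \<times> {0..k}) \<subseteq> {0..<p}" using p0 by (auto simp: f_def)
  then have "card (f ` ({0..k} \<times> {0..k})) \<le> nat p" using card_mono[of "{0..<p}"] by fastforce
  also have "\<dots> < nat ((k + 1)^2)" using k1 p0 k0 by simp
  also have "\<dots> = card ({0..k} \<times> {0..k})" using k0 by (simp add: card_cartesian_product power2_eq_square nat_mult_distrib)
  finally have "\<not> inj_on f ({0..k} \<times> {0..k})" by (rule pigeonhole)
  then obtain x y x' y' where xy: "{x, y, x', y'} \<subseteq> {0..k}" and ne: "(x, y) \<noteq> (x', y')" and eq: "f (x, y) = f (x', y')"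
    by (auto simp: inj_on_def)
  define u v where "u = x - x'" and "v = y - y'"
  have uv0: "u \<noteq> 0 \<or> v \<noteq> 0" using ne by (auto simp: u_def v_def)
  have "p dvd (x - r * y) - (x' - r * y')" using eq by (simp add: f_def mod_eq_dvd_iff)
  moreover have "(x - r * y) - (x' - r * y') = u - r * v" by (simp add: u_def v_def algebra_simps)
  ultimately have "p dvd u - r * v" by simp
  then have "p dvd (u - r * v) * (u + r * v + e * v) + (r^2 + e * r + 1) * v^2" by (rule dvd_add[OF dvd_mult2 dvd_mult2[OF r]])
  moreover have "(u - r * v) * (u + r * v + e * v) + (r^2 + e * r + 1) * v^2 = u^2 + e * u * v + v^2"
    by (simp add: power2_eq_square algebra_simps)
  ultimately have "p dvd u^2 + e * u * v + v^2" by simp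
  then obtain m where m: "u^2 + e * u * v + v^2 = p * m" by blast
  have "\<bar>u\<bar> \<le> k" "\<bar>v\<bar> \<le> k" using xy by (auto simp: u_def v_def)
  then have b: "u^2 \<le> k^2" "v^2 \<le> k^2" by (simp_all add: abs_le_square_iff[symmetric] k0)
  have "0 < u^2 + v^2" using uv0 by (simp add: sum_power2_gt_zero_iff)
  have q: "2 * (u * v) \<le> u^2 + v^2" "- (2 * (u * v)) \<le> u^2 + v^2"
    using zero_le_power2[of "u - v"] zero_le_power2[of "u + v"] by (simp_all add: power2_eq_square algebra_simps)
  have "0 < p * m" "p * m < p * 3" "e = 0 \<longrightarrow> p * m < p * 2"
    unfolding m[symmetric] using e b k2 q \<open>0 < u^2 + v^2\<close> by (auto simp: mult.assoc)
  then have m0: "0 < m" "m < 3" "e = 0 \<longrightarrow> m < 2" using p0 by (auto simp: zero_less_mult_iff)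
  have "m \<noteq> 2"
  proof
    assume "m = 2"
    then have e: "e = 1" using m0 e by auto
    then have "even (u^2 + u * v + v^2)" using m \<open>m = 2\<close> by simp
    then have "even u" "even v" by auto
    then obtain u' v' where "u = 2 * u'" "v = 2 * v'" by (elim evenE)
    then have "4 * (u'^2 + u' * v' + v'^2) = p * 2" using m \<open>m = 2\<close> e by (simp add: power2_eq_square algebra_simps)
    then have "p = 2 * (u'^2 + u' * v' + v'^2)" by simp
    then have "p = 2" using p by (metis dvd_triv_left primes_dvd_imp_eq two_is_prime_nat prime_nat_int_transfer prime_int_numeral_eq)
    then show False using chi e by (simp add: norm_char_def chi3_def)
  qed
  with m0 have "m = 1" by simp
  with m show ?thesis by auto
qed

text \<open>The elements of norm \<open>p n\<close> are the multiples by one of the two conjugate elements of norm \<open>p\<close>;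
  those counted twice are the multiples of \<open>p\<close>.\<close>

lemma reps_split:
  assumes e: "e = 0 \<or> e = 1" and p: "prime p" and chi: "norm_char e p = 1" and n: "n > 0"
  shows "card (reps e (p * n)) + (if p dvd n then card (reps e (n div p)) else 0) = 2 * card (reps e n)"
proof -
  obtain u v where uv: "u^2 + e * u * v + v^2 = p" using reps_split_exists[OF e p chi] by blast
  have p0: "p > 0" using p prime_gt_0_int by blast
  \<comment> \<open>Multiplication by u + v\<theta> and by its conjugate, written in the basis 1,
    \<theta> with \<theta>^2 = e\<theta> - 1.\<close>
  define f where "f = (\<lambda>(x, y). (u * x - v * y, u * y + v * x + e * v * y))"
  define g where "g = (\<lambda>(x, y). (u * x + e * v * x + v * y, u * y - v * x))"
  have fg: "f (g (x, y)) = (p * x, p * y)" "g (f (x, y)) = (p * x, p * y)" for x y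
    unfolding f_def g_def uv[symmetric] by (simp_all add: power2_eq_square algebra_simps)
  have inj: "inj_on f S" "inj_on g S" for S
    using fg p0 by (auto intro!: inj_onI) (metis Pair_inject mult_cancel_left less_irrefl surj_pair)+
  have fm: "f z \<in> reps e (p * m)" "g z \<in> reps e (p * m)" if "z \<in> reps e m" for z m
    using that unfolding f_def g_def reps_def uv[symmetric] by (auto simp: power2_eq_square algebra_simps)
  have norm: "p dvd x" if "(x, y) \<in> reps e (p * m)" "p dvd y" for x y m
  proof -
    have "x^2 = p * m - y * (e * x + y)" using that by (auto simp: reps_def power2_eq_square algebra_simps)
    then have "p dvd x^2" using that by simp
    then show ?thesis using p prime_dvd_power by blast
  qed
  have cover: "z \<in> f ` reps e n \<union> g ` reps e n" if z: "z \<in> reps e (p * n)" for z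
  proof -
    obtain x y where xy: "z = (x, y)" by (cases z)
    have h: "x^2 + e * x * y + y^2 = p * n" using z xy by (simp add: reps_def)
    \<comment> \<open>The two factors are the second coordinates of \<open>g z\<close> and
      \<open>f z\<close>, so \<open>p\<close> divides one of them. Then \<open>p\<close> divides
      that whole vector by \<open>norm\<close>, and applying the conjugate map to its quotient by
      \<open>p\<close> returns \<open>z\<close>.\<close>
    have "(u * y - v * x) * (u * y + v * x + e * v * y)
        = y^2 * (u^2 + e * u * v + v^2) - v^2 * (x^2 + e * x * y + y^2)"
      by (simp add: power2_eq_square algebra_simps)
    then have "(u * y - v * x) * (u * y + v * x + e * v * y) = p * (y^2 - v^2 * n)"
      unfolding uv h by (simp add: algebra_simps)
    then have "p dvd snd (g z) \<or> p dvd snd (f z)" using p by (simp add: f_def g_def xy prime_dvd_mult_iff[symmetric])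
    moreover have "z \<in> h ` reps e n"
      if "p dvd snd (h' z)" "h' z \<in> reps e (p * (p * n))" "h (h' z) = (p * x, p * y)"
        "\<And>x y. h (p * x, p * y) = (p * fst (h (x, y)), p * snd (h (x, y)))" for h h'
    proof -
      obtain a b where ab: "h' z = (a, b)" by (cases "h' z")
      then have "p dvd b" "p dvd a" using that norm[of a b "p * n"] by auto
      then obtain a' b' where ab': "a = p * a'" "b = p * b'" by (elim dvdE)
      have "(a', b') \<in> reps e n"
      proof -
        have "(p * a')^2 + e * (p * a') * (p * b') + (p * b')^2 = p * (p * n)" using that ab ab' by (simp add: reps_def)
        moreover have "(p * a')^2 + e * (p * a') * (p * b') + (p * b')^2 = p * (p * (a'^2 + e * a' * b' + b'^2))"
          by (simp add: power2_eq_square algebra_simps)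
        ultimately show ?thesis using p0 by (simp add: reps_def)
      qed
      moreover have hh: "h (p * a', p * b') = (p * x, p * y)" using that(3) ab ab' by simp
      moreover have "h (a', b') = z" using hh that(4)[of a' b'] p0 xy by (simp add: prod_eq_iff)
      ultimately show ?thesis by force
    qed
    moreover have "f (p * x, p * y) = (p * fst (f (x, y)), p * snd (f (x, y)))" for x y by (simp add: f_def algebra_simps)
    moreover have "g (p * x, p * y) = (p * fst (g (x, y)), p * snd (g (x, y)))" for x y by (simp add: g_def algebra_simps)
    ultimately show ?thesis using fg[of x y] fm[OF z] xy by (metis UnI1 UnI2)
  qed
  then have "reps e (p * n) = f ` reps e n \<union> g ` reps e n" using fm by blast
  moreover have "f ` reps e n \<inter> g ` reps e n = {(x, y) \<in> reps e (p * n). p dvd x \<and> p dvd y}"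
  proof (intro equalityI subsetI)
    fix z assume z: "z \<in> f ` reps e n \<inter> g ` reps e n"
    then have zr: "z \<in> reps e (p * n)" using fm by blast
    obtain x y where xy: "z = (x, y)" by (cases z)
    from z obtain a b where "z = f (a, b)" by (metis IntD1 imageE surj_pair)
    then have 1: "g (x, y) = (p * a, p * b)" using fg xy by simp
    from z obtain a' b' where "z = g (a', b')" by (metis IntD2 imageE surj_pair)
    then have 2: "f (x, y) = (p * a', p * b')" using fg xy by simp
    \<comment> \<open>\<open>2 * u + e * v\<close> is the trace of u + v\<theta>, and
      \<open>f\<close> and \<open>g\<close> add up to multiplication by it. It is prime to
      \<open>p\<close> because \<open>4 - e^2\<close>, the negative of the discriminant, is:
      \<open>p\<close> is unramified.\<close>
    have tr: "\<not> p dvd 2 * u + e * v"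
    proof
      assume d: "p dvd 2 * u + e * v"
      have "(4 - e^2) * v^2 = 4 * (u^2 + e * u * v + v^2) - (2 * u + e * v) * (2 * u + e * v)"
        by (simp add: power2_eq_square algebra_simps)
      then have "(4 - e^2) * v^2 = 4 * p - (2 * u + e * v) * (2 * u + e * v)" by (simp only: uv)
      then have "p dvd (4 - e^2) * v^2" using d by simp
      moreover have "\<not> p dvd 4 - e^2"
      proof
        assume "p dvd 4 - e^2"
        then have "p dvd 4 \<and> e = 0 \<or> p dvd 3 \<and> e = 1" using e by auto
        then have "p \<in> {1..4} \<and> e = 0 \<or> p \<in> {1..3} \<and> e = 1" using p0 by (auto dest: zdvd_imp_le)
        then have "p \<in> {1,2,3,4} \<and> e = 0 \<or> p \<in> {1,2,3} \<and> e = 1" by auto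
        with chi p \<open>p dvd 4 \<and> e = 0 \<or> p dvd 3 \<and> e = 1\<close> show False by (auto simp: norm_char_def chi3_def chi4_def)
      qed
      ultimately have "p dvd v" using p by (meson prime_dvd_mult_iff prime_dvd_power)
      moreover have "u^2 = p - v * (e * u + v)" unfolding uv[symmetric] by (simp add: power2_eq_square algebra_simps)
      ultimately have "p dvd u^2" by simp
      then have "p dvd u" using p prime_dvd_power by blast
      with \<open>p dvd v\<close> obtain u' v' where "u = p * u'" "v = p * v'" by (elim dvdE)
      then have "p * (p * (u'^2 + e * u' * v' + v'^2)) = p * 1" using uv by (simp add: power2_eq_square algebra_simps)
      then have "p * (u'^2 + e * u' * v' + v'^2) = 1" using p0 by simp
      then have "p dvd 1" by (metis dvd_triv_left)
      then show False using p not_prime_unit by blast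
    qed
    have "(2 * u + e * v) * x = p * (a + a')" "(2 * u + e * v) * y = p * (b + b')"
      using 1 2 by (simp_all add: f_def g_def algebra_simps)
    then have "p dvd x" "p dvd y" using tr p by (metis dvd_triv_left prime_dvd_mult_iff)+
    then show "z \<in> {(x, y) \<in> reps e (p * n). p dvd x \<and> p dvd y}" using zr xy by simp
  next
    fix z assume z: "z \<in> {(x, y) \<in> reps e (p * n). p dvd x \<and> p dvd y}"
    then obtain x y where xy: "z = (p * x, p * y)" "(p * x, p * y) \<in> reps e (p * n)" by (auto elim!: dvdE)
    have "p * (p * (x^2 + e * x * y + y^2)) = p * n" using xy(2) by (simp add: reps_def power2_eq_square algebra_simps)
    then have "(x, y) \<in> reps e (x^2 + e * x * y + y^2)" "n = p * (x^2 + e * x * y + y^2)" using p0 by (simp_all add: reps_def)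
    then have "f (x, y) \<in> reps e n" "g (x, y) \<in> reps e n" using fm by auto
    then show "z \<in> f ` reps e n \<inter> g ` reps e n" using fg[of x y] xy by (metis IntI image_eqI)
  qed
  moreover have "card {(x, y) \<in> reps e (p * n). p dvd x \<and> p dvd y} = (if p dvd n then card (reps e (n div p)) else 0)"
  proof (cases "p dvd n")
    case True
    then obtain m where m: "n = p * m" by blast
    then have eq: "p^2 * m = p * n" by (simp add: power2_eq_square)
    have "p \<noteq> 0" using p0 by simp
    from bij_betw_same_card[OF reps_scale[OF this, of e m]] show ?thesis
      unfolding eq using m \<open>p \<noteq> 0\<close> by simp
  next
    case False
    have empty: "{(x, y) \<in> reps e (p * n). p dvd x \<and> p dvd y} = {}"
    proof -
      have False if "(x, y) \<in> reps e (p * n)" "p dvd x" "p dvd y" for x y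
      proof -
        from that(2,3) obtain a b where "x = p * a" "y = p * b" by (elim dvdE)
        then have "p * (p * (a^2 + e * a * b + b^2)) = p * n" using that(1) by (simp add: reps_def power2_eq_square algebra_simps)
        then have "n = p * (a^2 + e * a * b + b^2)" using p0 by simp
        then show False using False by simp
      qed
      then show ?thesis by auto
    qed
    show ?thesis unfolding empty using False by simp
  qed
  ultimately show ?thesis
    using card_Un_Int[of "f ` reps e n" "g ` reps e n"] finite_reps[OF e, of n] card_image[OF inj(1), of "reps e n"] card_image[OF inj(2), of "reps e n"]
    by simp
qed

lemma norm_char_cases: "norm_char e p = 0 \<or> norm_char e p = 1 \<or> norm_char e p = -1"
  by (simp add: norm_char_def chi3_def chi4_def)

lemma reps_one:
  assumes e: "e = 0 \<or> e = 1"
  shows "int (card (reps e 1)) = (if e = 0 then 4 else 6)"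
proof -
  have b: "\<bar>x\<bar> \<le> 2 \<and> \<bar>y\<bar> \<le> 2" if "(x, y) \<in> reps e 1" for x y
    using that reps_bound[OF e, where x=x and y=y] by (simp add: reps_def)
  have "reps e 1 \<subseteq> {-2..2} \<times> {-2..2}" 
  proof
    fix z assume "z \<in> reps e 1"
    then show "z \<in> {-2..2} \<times> {-2..2}" using b[of "fst z" "snd z"] by (auto simp: abs_le_iff mem_Times_iff)
  qed
  also have "{-2..2} = {-2,-1,0,1,2::int}" by auto
  finally have "reps e 1 = {-2,-1,0,1,2} \<times> {-2,-1,0,1,2} \<inter> reps e 1" by (simp only: Int_absorb1)
  then have s: "reps e 1 = {z \<in> {-2,-1,0,1,2} \<times> {-2,-1,0,1,2}. z \<in> reps e 1}" by (simp only: Int_def mem_Collect_eq)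
  from e show ?thesis
  proof
    assume "e = 0"
    then have "reps e 1 = {(1,0),(-1,0),(0,1),(0,-1)}" by (subst s) (auto simp: reps_def)
    then show ?thesis using \<open>e = 0\<close> by simp
  next
    assume "e = 1"
    then have "reps e 1 = {(1,0),(-1,0),(0,1),(0,-1),(1,-1),(-1,1)}" by (subst s) (auto simp: reps_def)
    then show ?thesis using \<open>e = 1\<close> by simp
  qed
qed

text \<open>Strong induction removing one prime. Character value 0, 1 or -1 means ramified, split or
  inert, and in each case the recursion for \<open>reps\<close> is that of
  \<open>divisor_sum_prime_mult\<close>. The factors 4 and 6 are the numbers of units, that is, the
  case \<open>n = 1\<close>.\<close>

lemma card_reps:
  assumes e: "e = 0 \<or> e = 1" and "n > 0"
  shows "int (card (reps e n)) = (if e = 0 then 4 else 6) * divisor_sum (norm_char e) n"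
  using \<open>n > 0\<close>
proof (induction "nat n" arbitrary: n rule: less_induct)
  case less
  define w :: int where "w = (if e = 0 then 4 else 6)"
  have mult: "norm_char e (a * b) = norm_char e a * norm_char e b" for a b
    by (simp add: norm_char_def chi3_mult chi4_mult)
  have "int (card (reps e n)) = w * divisor_sum (norm_char e) n"
  proof (cases "n = 1")
    case True
    have "{d::int. 0 < d \<and> d dvd 1} = {1}" by auto
    then have "divisor_sum (norm_char e) 1 = 1" by (simp add: divisor_sum_def norm_char_def chi3_def chi4_def)
    then show ?thesis using reps_one[OF e] True by (simp add: w_def)
  next
    case False
    then obtain p where p: "prime p" "p dvd n" using prime_divisor_exists[of n] less.prems by auto
    then obtain m where m: "n = p * m" by blast
    have p1: "p > 1" using p prime_gt_1_int by blast
    have m0: "m > 0" using m less.prems p1 by (simp add: zero_less_mult_iff)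
    have mn: "m < n" using m p1 m0 by simp
    have IH: "int (card (reps e m)) = w * divisor_sum (norm_char e) m"
      using less.hyps[of m] mn m0 by (simp add: w_def)
    have IH': "int (card (reps e (m div p))) = w * divisor_sum (norm_char e) (m div p)" if "p dvd m"
    proof -
      from that obtain l where "m = p * l" by blast
      then have "m div p = l" "0 < l" "l < n" using m0 mn p1 by (auto simp: zero_less_mult_iff intro: le_less_trans[rotated])
      then show ?thesis using less.hyps[of l] by (simp add: w_def)
    qed
    have D: "divisor_sum (norm_char e) n = (1 + norm_char e p) * divisor_sum (norm_char e) m
        - (if p dvd m then norm_char e p * divisor_sum (norm_char e) (m div p) else 0)"
      unfolding m by (rule divisor_sum_prime_mult[OF mult p(1) m0])
    consider "norm_char e p = 0" | "norm_char e p = 1" | "norm_char e p = -1" using norm_char_cases by blast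
    then show ?thesis
    proof cases
      case 1
      have "card (reps e (p * m)) = card (reps e m)"
        using e
      proof
        assume e: "e = 0"
        then have "p mod 4 \<noteq> 1" "p mod 4 \<noteq> 3" using 1 by (auto simp: norm_char_def chi4_def split: if_splits)
        then have "2 dvd p" by presburger
        then have "p = 2" using p(1) primes_dvd_imp_eq[of 2 p] by simp
        then show ?thesis using e reps_two by simp
      next
        assume e: "e = 1"
        then have "p mod 3 \<noteq> 1" "p mod 3 \<noteq> 2" using 1 by (auto simp: norm_char_def chi3_def split: if_splits)
        then have "3 dvd p" by presburger
        then have "p = 3" using p(1) primes_dvd_imp_eq[of 3 p] by simp
        then show ?thesis using e reps_three by simp
      qed
      then show ?thesis using IH D 1 m by simp
    next
      case 2
      have "int (card (reps e (p * m))) = 2 * int (card (reps e m)) - (if p dvd m then int (card (reps e (m div p))) else 0)"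
        using reps_split[OF e p(1) 2 m0] by (cases "p dvd m") simp_all
      also have "\<dots> = w * ((1 + 1) * divisor_sum (norm_char e) m - (if p dvd m then 1 * divisor_sum (norm_char e) (m div p) else 0))"
        unfolding IH using IH' by (cases "p dvd m") (simp_all add: right_diff_distrib)
      finally show ?thesis unfolding D 2 using m by simp
    next
      case 3
      have "int (card (reps e (p * m))) = (if p dvd m then int (card (reps e (m div p))) else 0)"
        unfolding reps_inert[OF e p(1) 3 m0] by simp
      also have "\<dots> = w * ((1 + - 1) * divisor_sum (norm_char e) m - (if p dvd m then - 1 * divisor_sum (norm_char e) (m div p) else 0))"
        using IH' by (cases "p dvd m") simp_all
      finally show ?thesis unfolding D 3 using m by simp
    qed
  qed
  then show ?case by (simp add: w_def)
qed

section \<open>Liouville's identity\<close>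

definition solutions :: "int \<Rightarrow> (int \<times> int \<times> int \<times> int) set" where
  "solutions n = {(a, b, x, y). 0 < a \<and> 0 < b \<and> 0 < x \<and> 0 < y \<and> a * x + b * y = n}"

lemma solutions_bound:
  assumes "(a, b, x, y) \<in> solutions n"
  shows "a < n" "b < n" "x < n" "y < n"
proof -
  have p: "0 < a" "0 < b" "0 < x" "0 < y" and n: "n = a * x + b * y" using assms by (auto simp: solutions_def)
  have "a * 1 \<le> a * x" "1 * x \<le> a * x" "b * 1 \<le> b * y" "1 * y \<le> b * y"
    using p by (intro mult_left_mono mult_right_mono; simp)+
  then show "a < n" "b < n" "x < n" "y < n" using p unfolding n by linarith+
qed

lemma finite_solutions [simp]: "finite (solutions n)"
proof (rule finite_subset)
  show "solutions n \<subseteq> {0..n} \<times> {0..n} \<times> {0..n} \<times> {0..n}"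
  proof
    fix s assume s: "s \<in> solutions n"
    obtain a b x y where e: "s = (a, b, x, y)" by (cases s)
    show "s \<in> {0..n} \<times> {0..n} \<times> {0..n} \<times> {0..n}"
      using solutions_bound[of a b x y n] s unfolding e by (auto simp: solutions_def)
  qed
qed simp

text \<open>The summand sees only \<open>a\<close> and \<open>b\<close>; the cofactors enter through
  \<open>P\<close> alone. This lets a shear trade a condition on \<open>a, b\<close> for one on
  \<open>x, y\<close>.\<close>

definition sol_sum :: "int \<Rightarrow> (int \<Rightarrow> int \<Rightarrow> int \<Rightarrow> int \<Rightarrow> bool) \<Rightarrow> (int \<Rightarrow> int \<Rightarrow> int) \<Rightarrow> int" where
  "sol_sum n P h = (\<Sum>(a, b, x, y) \<in> {(a, b, x, y) \<in> solutions n. P a b x y}. h a b)"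

lemma sol_sum_split:
  assumes "\<And>a b x y. P a b x y \<longleftrightarrow> Q a b x y \<or> R a b x y" "\<And>a b x y. \<not> (Q a b x y \<and> R a b x y)"
  shows "sol_sum n P h = sol_sum n Q h + sol_sum n R h"
proof -
  have fin: "finite {(a, b, x, y) \<in> solutions n. T a b x y}" for T
    by (rule finite_subset[OF _ finite_solutions[of n]]) auto
  have "{(a, b, x, y) \<in> solutions n. P a b x y} = {(a, b, x, y) \<in> solutions n. Q a b x y} \<union> {(a, b, x, y) \<in> solutions n. R a b x y}"
    using assms(1) by auto
  moreover have "{(a, b, x, y) \<in> solutions n. Q a b x y} \<inter> {(a, b, x, y) \<in> solutions n. R a b x y} = {}"
    using assms(2) by auto
  ultimately show ?thesis unfolding sol_sum_def using fin by (simp add: sum.union_disjoint)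
qed

lemma sol_sum_swap: "sol_sum n P h = sol_sum n (\<lambda>a b x y. P b a y x) (\<lambda>a b. h b a)"
  unfolding sol_sum_def
  by (rule sum.reindex_bij_witness[where i = "\<lambda>(a, b, x, y). (b, a, y, x)" and j = "\<lambda>(a, b, x, y). (b, a, y, x)"])
     (auto simp: solutions_def algebra_simps)

text \<open>One step of the subtractive Euclidean algorithm: a x + b y = (a - b) x + b (x +
  y).\<close>

lemma sol_sum_shear:
  "sol_sum n (\<lambda>a b x y. b < a) h = sol_sum n (\<lambda>a b x y. x < y) (\<lambda>a b. h (a + b) b)"
  unfolding sol_sum_def
  by (rule sum.reindex_bij_witness[where i = "\<lambda>(a, b, x, y). (a + b, b, x, y - x)" and j = "\<lambda>(a, b, x, y). (a - b, b, x, x + y)"])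
     (auto simp: solutions_def algebra_simps)

lemma sol_sum_shear':
  "sol_sum n (\<lambda>a b x y. a < b) h = sol_sum n (\<lambda>a b x y. y < x) (\<lambda>a b. h a (a + b))"
  using sol_sum_shear[of n "\<lambda>a b. h b a"]
  by (subst (1 2) sol_sum_swap) (simp add: add.commute)

lemma sol_sum_add: "sol_sum n P (\<lambda>a b. f a b + g a b) = sol_sum n P f + sol_sum n P g"
  unfolding sol_sum_def by (simp add: sum.distrib[symmetric] split_def)

lemma sol_sum_diff: "sol_sum n P (\<lambda>a b. f a b - g a b) = sol_sum n P f - sol_sum n P g"
  unfolding sol_sum_def by (simp add: sum_subtractf[symmetric] split_def)

lemma sol_sum_trichotomy:
  "sol_sum n (\<lambda>_ _ _ _. True) h =
    sol_sum n (\<lambda>a b x y. b < a) h + sol_sum n (\<lambda>a b x y. a < b) h + sol_sum n (\<lambda>a b x y. a = b) h"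
  "sol_sum n (\<lambda>_ _ _ _. True) h =
    sol_sum n (\<lambda>a b x y. x < y) h + sol_sum n (\<lambda>a b x y. y < x) h + sol_sum n (\<lambda>a b x y. x = y) h"
proof -
  have "sol_sum n (\<lambda>_ _ _ _. True) h = sol_sum n (\<lambda>a b x y. b < a \<or> a < b) h + sol_sum n (\<lambda>a b x y. a = b) h"
    "sol_sum n (\<lambda>_ _ _ _. True) h = sol_sum n (\<lambda>a b x y. x < y \<or> y < x) h + sol_sum n (\<lambda>a b x y. x = y) h"
    by (rule sol_sum_split; auto)+
  moreover have "sol_sum n (\<lambda>a b x y. b < a \<or> a < b) h = sol_sum n (\<lambda>a b x y. b < a) h + sol_sum n (\<lambda>a b x y. a < b) h"
    "sol_sum n (\<lambda>a b x y. x < y \<or> y < x) h = sol_sum n (\<lambda>a b x y. x < y) h + sol_sum n (\<lambda>a b x y. y < x) h"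
    by (rule sol_sum_split; auto)+
  ultimately show "sol_sum n (\<lambda>_ _ _ _. True) h =
      sol_sum n (\<lambda>a b x y. b < a) h + sol_sum n (\<lambda>a b x y. a < b) h + sol_sum n (\<lambda>a b x y. a = b) h"
    "sol_sum n (\<lambda>_ _ _ _. True) h =
      sol_sum n (\<lambda>a b x y. x < y) h + sol_sum n (\<lambda>a b x y. y < x) h + sol_sum n (\<lambda>a b x y. x = y) h"
    by simp_all
qed

text \<open>Splitting the sums over \<open>F a (a - b)\<close>, \<open>F (b - a) b\<close> and \<open>F a b\<close> according to the sign of \<open>a - b\<close>
  and shearing turns everything into sums restricted by \<open>x < y\<close> or \<open>y < x\<close>, which cancel.\<close>

lemma liouville_identity:
  fixes F :: "int \<Rightarrow> int \<Rightarrow> int"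
  assumes even: "\<And>a b. F (-a) (-b) = F a b"
  shows "sol_sum n (\<lambda>_ _ _ _. True)
      (\<lambda>a b. F a b - F a (-b) + F a (a - b) - F a (a + b) + F (b - a) b - F (a + b) b) =
    sol_sum n (\<lambda>a b x y. a = b) (\<lambda>a b. F a 0 + F 0 a + F a a)
    - sol_sum n (\<lambda>a b x y. x = y) (\<lambda>a b. F a (-b) + F (a + b) b + F a (a + b))"
proof -
  let ?T = "sol_sum n (\<lambda>_ _ _ _. True)"
  let ?gt = "sol_sum n (\<lambda>a b x y. b < a)" and ?lt = "sol_sum n (\<lambda>a b x y. a < b)" and ?eq = "sol_sum n (\<lambda>a b x y. a = b)"
  let ?xlt = "sol_sum n (\<lambda>a b x y. x < y)" and ?xgt = "sol_sum n (\<lambda>a b x y. y < x)" and ?xeq = "sol_sum n (\<lambda>a b x y. x = y)"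
  have ev: "F (-a) b = F a (-b)" for a b using even[of a "-b"] by simp
  have eqc: "?eq h = ?eq k" if "\<And>a. h a a = k a a" for h k
    unfolding sol_sum_def by (rule sum.cong) (auto simp: that)
  have 1: "?T (\<lambda>a b. F a (a - b)) = ?xlt (\<lambda>a b. F (a + b) a) + ?xgt (\<lambda>a b. F a (- b)) + ?eq (\<lambda>a b. F a 0)"
    unfolding sol_sum_trichotomy(1)[of n "\<lambda>a b. F a (a - b)"] sol_sum_shear[of n "\<lambda>a b. F a (a - b)"] sol_sum_shear'[of n "\<lambda>a b. F a (a - b)"]
    using eqc[of "\<lambda>a b. F a (a - b)" "\<lambda>a b. F a 0"] by simp
  have 2: "?T (\<lambda>a b. F (b - a) b) = ?xlt (\<lambda>a b. F a (- b)) + ?xgt (\<lambda>a b. F b (a + b)) + ?eq (\<lambda>a b. F 0 a)"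
    unfolding sol_sum_trichotomy(1)[of n "\<lambda>a b. F (b - a) b"] sol_sum_shear[of n "\<lambda>a b. F (b - a) b"] sol_sum_shear'[of n "\<lambda>a b. F (b - a) b"]
    using eqc[of "\<lambda>a b. F (b - a) b" "\<lambda>a b. F 0 a"] by (simp add: ev)
  have 3: "?xlt (\<lambda>a b. F (a + b) a) = ?xgt (\<lambda>a b. F (a + b) b)"
    using sol_sum_swap[of n "\<lambda>a b x y. x < y" "\<lambda>a b. F (a + b) a"] by (simp add: add.commute)
  have 4: "?xgt (\<lambda>a b. F b (a + b)) = ?xlt (\<lambda>a b. F a (a + b))"
    using sol_sum_swap[of n "\<lambda>a b x y. y < x" "\<lambda>a b. F b (a + b)"] by (simp add: add.commute)
  have 5: "?T F = ?xlt (\<lambda>a b. F (a + b) b) + ?xgt (\<lambda>a b. F a (a + b)) + ?eq (\<lambda>a b. F a a)"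
    unfolding sol_sum_trichotomy(1)[of n F] sol_sum_shear[of n F] sol_sum_shear'[of n F]
    using eqc[of F "\<lambda>a b. F a a"] by simp
  show ?thesis
    unfolding sol_sum_add sol_sum_diff 1 2 3 4 5
      sol_sum_trichotomy(2)[of n "\<lambda>a b. F a (-b)"] sol_sum_trichotomy(2)[of n "\<lambda>a b. F a (a + b)"]
      sol_sum_trichotomy(2)[of n "\<lambda>a b. F (a + b) b"]
    by simp
qed

text \<open>With a = b = d the equation reads d (x + y) = n, which leaves \<open>n div d - 1\<close>
  positive choices of x.\<close>

lemma sol_sum_diagonal:
  assumes "n > 0"
  shows "sol_sum n (\<lambda>a b x y. a = b) (\<lambda>a b. k a) = (\<Sum>d | 0 < d \<and> d dvd n. k d * (n div d - 1))"
proof -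
  have "sol_sum n (\<lambda>a b x y. a = b) (\<lambda>a b. k a) = (\<Sum>(d, x)\<in>(SIGMA d:{d. 0 < d \<and> d dvd n}. {0<..<n div d}). k d)"
    unfolding sol_sum_def
  proof (rule sum.reindex_bij_witness[where i = "\<lambda>(d, x). (d, d, x, n div d - x)" and j = "\<lambda>(a, b, x, y). (a, x)"])
    fix s assume s: "s \<in> {(a, b, x, y) \<in> solutions n. a = b}"
    then obtain a x y where e: "s = (a, a, x, y)" and p: "0 < a" "0 < x" "0 < y" and "a * x + a * y = n"
      by (auto simp: solutions_def)
    then have n: "n = a * (x + y)" by (simp add: distrib_left)
    then have "n div a = x + y" using p by simp
    then show "(case case s of (a, b, x, y) \<Rightarrow> (a, x) of (d, x) \<Rightarrow> (d, d, x, n div d - x)) = s"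
      "(case s of (a, b, x, y) \<Rightarrow> (a, x)) \<in> (SIGMA d:{d. 0 < d \<and> d dvd n}. {0<..<n div d})"
      "(case case s of (a, b, x, y) \<Rightarrow> (a, x) of (d, x) \<Rightarrow> k d) = (case s of (a, b, x, y) \<Rightarrow> k a)"
      using p n unfolding e by simp_all
  next
    fix t assume "t \<in> (SIGMA d:{d. 0 < d \<and> d dvd n}. {0<..<n div d})"
    then obtain d x where e: "t = (d, x)" and p: "0 < d" "d dvd n" "0 < x" "x < n div d" by auto
    then have "d * x + d * (n div d - x) = n" by (simp add: right_diff_distrib)
    then show "(case t of (d, x) \<Rightarrow> (d, d, x, n div d - x)) \<in> {(a, b, x, y) \<in> solutions n. a = b}"
      "(case case t of (d, x) \<Rightarrow> (d, d, x, n div d - x) of (a, b, x, y) \<Rightarrow> (a, x)) = t"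
      using p unfolding e by (simp_all add: solutions_def)
  qed
  also have "\<dots> = (\<Sum>d | 0 < d \<and> d dvd n. \<Sum>x\<in>{0<..<n div d}. k d)"
    using assms by (subst sum.Sigma) auto
  also have "\<dots> = (\<Sum>d | 0 < d \<and> d dvd n. k d * (n div d - 1))"
  proof (rule sum.cong[OF refl])
    fix d assume "d \<in> {d. 0 < d \<and> d dvd n}"
    then have "n div d > 0" using assms by (auto simp: zero_less_mult_iff)
    then show "(\<Sum>x\<in>{0<..<n div d}. k d) = k d * (n div d - 1)" by (simp add: mult.commute)
  qed
  finally show ?thesis .
qed

text \<open>With x = y the sum d = a + b is a divisor of n and determines x.\<close>

lemma sol_sum_codiagonal:
  assumes "n > 0"
  shows "sol_sum n (\<lambda>a b x y. x = y) k = (\<Sum>d | 0 < d \<and> d dvd n. \<Sum>a\<in>{0<..<d}. k a (d - a))"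
proof -
  have "sol_sum n (\<lambda>a b x y. x = y) k = (\<Sum>(d, a)\<in>(SIGMA d:{d. 0 < d \<and> d dvd n}. {0<..<d}). k a (d - a))"
    unfolding sol_sum_def
  proof (rule sum.reindex_bij_witness[where i = "\<lambda>(d, a). (a, d - a, n div d, n div d)" and j = "\<lambda>(a, b, x, y). (a + b, a)"])
    fix s assume s: "s \<in> {(a, b, x, y) \<in> solutions n. x = y}"
    then obtain a b x where e: "s = (a, b, x, x)" and p: "0 < a" "0 < b" "0 < x" and "a * x + b * x = n"
      by (auto simp: solutions_def)
    then have n: "n = (a + b) * x" by (simp add: distrib_right)
    then have "n div (a + b) = x" using p by simp
    then show "(case case s of (a, b, x, y) \<Rightarrow> (a + b, a) of (d, a) \<Rightarrow> (a, d - a, n div d, n div d)) = s"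
      "(case s of (a, b, x, y) \<Rightarrow> (a + b, a)) \<in> (SIGMA d:{d. 0 < d \<and> d dvd n}. {0<..<d})"
      "(case case s of (a, b, x, y) \<Rightarrow> (a + b, a) of (d, a) \<Rightarrow> k a (d - a)) = (case s of (a, b, x, y) \<Rightarrow> k a b)"
      using p n unfolding e by simp_all
  next
    fix t assume "t \<in> (SIGMA d:{d. 0 < d \<and> d dvd n}. {0<..<d})"
    then obtain d a where e: "t = (d, a)" and p: "0 < d" "d dvd n" "0 < a" "a < d" by auto
    have "n div d > 0" using assms p by (auto simp: zero_less_mult_iff)
    moreover have "a * (n div d) + (d - a) * (n div d) = n" using p by (simp add: left_diff_distrib)
    ultimately show "(case t of (d, a) \<Rightarrow> (a, d - a, n div d, n div d)) \<in> {(a, b, x, y) \<in> solutions n. x = y}"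
      "(case case t of (d, a) \<Rightarrow> (a, d - a, n div d, n div d) of (a, b, x, y) \<Rightarrow> (a + b, a)) = t"
      using p unfolding e by (simp_all add: solutions_def)
  qed
  also have "\<dots> = (\<Sum>d | 0 < d \<and> d dvd n. \<Sum>a\<in>{0<..<d}. k a (d - a))"
    using assms by (subst sum.Sigma) auto
  finally show ?thesis .
qed

text \<open>Solutions are grouped by the value \<open>c = a * x\<close>; then \<open>a\<close> runs
  through the divisors of \<open>c\<close> and \<open>b\<close> through those of
  \<open>n - c\<close>.\<close>

lemma sol_sum_convolution:
  "sol_sum n (\<lambda>_ _ _ _. True) (\<lambda>a b. f a * g b) = (\<Sum>c\<in>{0<..<n}. divisor_sum f c * divisor_sum g (n - c))"
proof -
  let ?D = "\<lambda>c. {d::int. 0 < d \<and> d dvd c}"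
  have "sol_sum n (\<lambda>_ _ _ _. True) (\<lambda>a b. f a * g b) =
      (\<Sum>(c, a, b)\<in>(SIGMA c:{0<..<n}. ?D c \<times> ?D (n - c)). f a * g b)"
    unfolding sol_sum_def
  proof (rule sum.reindex_bij_witness[where i = "\<lambda>(c, a, b). (a, b, c div a, (n - c) div b)" and j = "\<lambda>(a, b, x, y). (a * x, a, b)"])
    fix s assume s: "s \<in> {(a, b, x, y) \<in> solutions n. True}"
    then obtain a b x y where e: "s = (a, b, x, y)" and p: "0 < a" "0 < b" "0 < x" "0 < y" and n: "n = a * x + b * y"
      by (auto simp: solutions_def)
    then have "n - a * x = b * y" "0 < a * x" "0 < b * y" by auto
    then show "(case case s of (a, b, x, y) \<Rightarrow> (a * x, a, b) of (c, a, b) \<Rightarrow> (a, b, c div a, (n - c) div b)) = s"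
      "(case s of (a, b, x, y) \<Rightarrow> (a * x, a, b)) \<in> (SIGMA c:{0<..<n}. ?D c \<times> ?D (n - c))"
      "(case case s of (a, b, x, y) \<Rightarrow> (a * x, a, b) of (c, a, b) \<Rightarrow> f a * g b) = (case s of (a, b, x, y) \<Rightarrow> f a * g b)"
      using p unfolding e n by simp_all
  next
    fix t assume "t \<in> (SIGMA c:{0<..<n}. ?D c \<times> ?D (n - c))"
    then obtain c a b where e: "t = (c, a, b)" and p: "0 < c" "c < n" "0 < a" "a dvd c" "0 < b" "b dvd n - c" by auto
    then have "0 < c div a" "0 < (n - c) div b" "a * (c div a) = c" "b * ((n - c) div b) = n - c"
      by (auto simp: pos_imp_zdiv_pos_iff zdvd_imp_le)
    then show "(case t of (c, a, b) \<Rightarrow> (a, b, c div a, (n - c) div b)) \<in> {(a, b, x, y) \<in> solutions n. True}"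
      "(case case t of (c, a, b) \<Rightarrow> (a, b, c div a, (n - c) div b) of (a, b, x, y) \<Rightarrow> (a * x, a, b)) = t"
      using p unfolding e by (simp_all add: solutions_def)
  qed
  also have "\<dots> = (\<Sum>c\<in>{0<..<n}. \<Sum>(a, b)\<in>?D c \<times> ?D (n - c). f a * g b)"
    by (subst sum.Sigma) auto
  also have "\<dots> = (\<Sum>c\<in>{0<..<n}. divisor_sum f c * divisor_sum g (n - c))"
    unfolding divisor_sum_def sum_product by (simp add: sum.cartesian_product)
  finally show ?thesis .
qed

section \<open>Convolution of the characters modulo 3 and 4\<close>

text \<open>On odd positive arguments this is (3/a), see \<open>kronecker_3\<close>. As a product of
  two odd characters it is even, which is the symmetry that \<open>liouville_identity\<close>
  demands.\<close>

definition chi12 :: "int \<Rightarrow> int" where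
  "chi12 a = chi3 a * chi4 a"

lemma chi12_mult: "chi12 (a * b) = chi12 a * chi12 b"
  by (simp add: chi12_def chi3_mult chi4_mult)

lemma chi_minus: "chi3 (-a) = - chi3 a" "chi4 (-a) = - chi4 a"
proof -
  have "chi3 (- 1) = -1" "chi4 (- 1) = -1" by (simp_all add: chi3_def chi4_def)
  then show "chi3 (-a) = - chi3 a" "chi4 (-a) = - chi4 a"
    using chi3_mult[of "-1" a] chi4_mult[of "-1" a] by simp_all
qed

lemma chi12_minus [simp]: "chi12 (-a) = chi12 a"
  by (simp add: chi12_def chi_minus)

lemma chi_mod: "chi3 (a mod 12) = chi3 a" "chi4 (a mod 12) = chi4 a" "chi12 (a mod 12) = chi12 a"
  by (simp_all add: chi3_def chi4_def chi12_def mod_mod_cancel)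

lemma chi12_cong: "a mod 12 = b mod 12 \<Longrightarrow> chi12 a = chi12 b"
  by (metis chi_mod(3))

text \<open>This function combines the three instances \<open>\<chi>\<^sub>1\<^sub>2(a + kb)\<close>, \<open>k = 1, 2, 3\<close>, of Liouville's
  identity so that after symmetrization in \<open>a, b\<close> only \<open>\<chi>\<^sub>3(a) \<chi>\<^sub>4(b)\<close> with \<open>a\<close> even remains.\<close>

definition liouville_fun :: "int \<Rightarrow> int \<Rightarrow> int" where
  "liouville_fun a b = chi12 (a + b) + chi12 (a + 2 * b) - chi12 (a + 3 * b)"

lemma liouville_fun_mod: "liouville_fun (a mod 12) (b mod 12) = liouville_fun a b"
  unfolding liouville_fun_def by (intro arg_cong2[where f = "(+)"] arg_cong2[where f = "(-)"] chi12_cong)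
    (simp_all add: mod_simps, (metis mod_add_right_eq mod_mult_right_eq)+)

lemma liouville_fun_cong: "a mod 12 = a' mod 12 \<Longrightarrow> b mod 12 = b' mod 12 \<Longrightarrow> liouville_fun a b = liouville_fun a' b'"
  by (metis liouville_fun_mod)

text \<open>The weights of the kernel functions are those for which
  \<open>liouville_kernel_residues\<close> holds. They match the binary counts: 8 turns into -8
  since \<open>chi3 2 = -1\<close>, and -2 * (-8) = 4 * 4 belongs to two pairs of odd variables,
  while 2 * (-12) * (-1) = 6 * 4 belongs to an unrestricted Eisenstein pair and an odd pair.\<close>

definition kernel_a :: "int \<Rightarrow> int" where
  "kernel_a a = chi3 a * (if a mod 4 = 2 then 8 else if a mod 4 = 0 then 4 else 0)"

definition kernel_a3 :: "int \<Rightarrow> int" where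
  "kernel_a3 a = (if a mod 4 = 0 then - 12 * chi3 a else 0)"

definition kernel_b3 :: "int \<Rightarrow> int" where
  "kernel_b3 b = (if b mod 3 = 0 then chi4 b else 0)"

definition liouville_term :: "int \<Rightarrow> int \<Rightarrow> int" where
  "liouville_term a b = liouville_fun a b - liouville_fun a (-b) + liouville_fun a (a - b) - liouville_fun a (a + b) + liouville_fun (b - a) b - liouville_fun (a + b) b"

definition kernel :: "int \<Rightarrow> int \<Rightarrow> int" where
  "kernel a b = kernel_a a * chi4 b + kernel_a3 a * kernel_b3 b"

lemma liouville_term_mod: "liouville_term (a mod 12) (b mod 12) = liouville_term a b"
  unfolding liouville_term_def
  by (intro arg_cong2[where f = "(+)"] arg_cong2[where f = "(-)"] liouville_fun_cong) (simp_all add: mod_simps)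

lemma kernel_mod: "kernel (a mod 12) (b mod 12) = kernel a b"
  unfolding kernel_def kernel_a_def kernel_a3_def kernel_b3_def chi_mod
  by (simp add: mod_mod_cancel)

lemma int_mod_12_cases:
  "(a::int) mod 12 \<in> {0,1,2,3,4,5,6,7,8,9,10,11}"
  by (simp, presburger)

text \<open>All functions involved have period 12 in both arguments, so 144 evaluations settle the
  identity for all integers. Comparing the sums over both orders of \<open>a, b\<close> suffices,
  because interchanging the two halves of a solution preserves the full sum.\<close>

lemma liouville_kernel_residues:
  "\<forall>a\<in>{0,1,2,3,4,5,6,7,8,9,10,11::int}. \<forall>b\<in>{0,1,2,3,4,5,6,7,8,9,10,11::int}.
     liouville_term a b + liouville_term b a = - (kernel a b + kernel b a)"
  by code_simp

lemma liouville_kernel: "liouville_term a b + liouville_term b a = - (kernel a b + kernel b a)"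
proof -
  have "liouville_term (a mod 12) (b mod 12) + liouville_term (b mod 12) (a mod 12) = - (kernel (a mod 12) (b mod 12) + kernel (b mod 12) (a mod 12))"
    by (rule liouville_kernel_residues[THEN bspec, THEN bspec]) (rule int_mod_12_cases)+
  then show ?thesis by (simp only: kernel_mod liouville_term_mod)
qed

lemma liouville_fun_even: "liouville_fun (-a) (-b) = liouville_fun a b"
proof -
  have "liouville_fun (-a) (-b) = chi12 (- (a + b)) + chi12 (- (a + 2 * b)) - chi12 (- (a + 3 * b))"
    unfolding liouville_fun_def by (simp add: algebra_simps)
  then show ?thesis unfolding chi12_minus liouville_fun_def .
qed

lemma liouville_term_sum:
  assumes "n > 0"
  shows "sol_sum n (\<lambda>_ _ _ _. True) liouville_term =
    (\<Sum>d | 0 < d \<and> d dvd n. (liouville_fun d 0 + liouville_fun 0 d + liouville_fun d d) * (n div d - 1))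
    - (\<Sum>d | 0 < d \<and> d dvd n. \<Sum>a\<in>{0<..<d}. liouville_fun a (a - d) + liouville_fun d (d - a) + liouville_fun a d)"
proof -
  have "sol_sum n (\<lambda>_ _ _ _. True) liouville_term =
     sol_sum n (\<lambda>a b x y. a = b) (\<lambda>a b. liouville_fun a 0 + liouville_fun 0 a + liouville_fun a a)
    - sol_sum n (\<lambda>a b x y. x = y) (\<lambda>a b. liouville_fun a (-b) + liouville_fun (a + b) b + liouville_fun a (a + b))"
    unfolding liouville_term_def[abs_def] by (rule liouville_identity) (rule liouville_fun_even)
  then show ?thesis
    unfolding sol_sum_diagonal[OF assms] sol_sum_codiagonal[OF assms] by simp
qed

text \<open>The codiagonal summand of \<open>liouville_identity\<close> at b = d - a.\<close>

definition boundary_term :: "int \<Rightarrow> int \<Rightarrow> int" where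
  "boundary_term d a = liouville_fun a (a - d) + liouville_fun d (d - a) + liouville_fun a d"

lemma boundary_term_mod: "boundary_term (d mod 12) (a mod 12) = boundary_term d a"
  unfolding boundary_term_def
  by (intro arg_cong2[where f = "(+)"] liouville_fun_cong) (simp_all add: mod_simps)

lemma boundary_term_cong: "d mod 12 = d' mod 12 \<Longrightarrow> a mod 12 = a' mod 12 \<Longrightarrow> boundary_term d a = boundary_term d' a'"
  by (metis boundary_term_mod)

lemma sum_periodic:
  fixes p :: "nat \<Rightarrow> int"
  assumes "\<And>i. p (m + i) = p i"
  shows "(\<Sum>i<m * k + r. p i) = int k * (\<Sum>i<m. p i) + (\<Sum>i<r. p i)"
proof (induction k)
  case (Suc k)
  have split: "(\<Sum>i<m + j. p i) = (\<Sum>i<m. p i) + (\<Sum>i<j. p i)" for j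
    by (induction j) (simp_all add: assms)
  have "(\<Sum>i<m * Suc k + r. p i) = (\<Sum>i<m + (m * k + r). p i)" by (simp add: algebra_simps)
  then show ?case using Suc split[of "m * k + r"] by (simp add: algebra_simps)
qed simp

text \<open>A full period in \<open>a\<close> contributes nothing, so for d = 12k + r only the first
  r - 1 terms remain. The shift by 1 reflects that \<open>a\<close> starts at 1.\<close>

lemma boundary_term_residues:
  "\<forall>r\<in>{1,3,5,7,9,11::nat}. sum_list (map (\<lambda>i. boundary_term (int r) (int i + 1)) [0..<12]) = 0 \<and>
     sum_list (map (\<lambda>i. boundary_term (int r) (int i + 1)) [0..<r - 1]) =
       - 2 * chi12 (int r) + 2 * chi4 (int r) + 2 * kernel_b3 (int r)"
  by code_simp

lemma boundary_term_sum:
  assumes "d > 0" "odd d"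
  shows "(\<Sum>a\<in>{0<..<d}. boundary_term d a) = - 2 * chi12 d + 2 * chi4 d + 2 * kernel_b3 d"
proof -
  have conv: "sum_list (map f [0..<m]) = (\<Sum>i<m. f i)" for f :: "nat \<Rightarrow> int" and m
    by (simp add: interv_sum_list_conv_sum_set_nat atLeast0LessThan)
  define k r where "k = nat (d div 12)" and "r = nat (d mod 12)"
  have d: "d = 12 * int k + int r" using assms by (simp add: k_def r_def)
  have r: "r \<in> {1,3,5,7,9,11}"
  proof -
    have "d mod 12 \<in> {1,3,5,7,9,11}" using assms(2) by (simp, presburger)
    then show ?thesis unfolding r_def by auto
  qed
  have "boundary_term d a = boundary_term (int r) a" for a
  proof -
    have "d mod 12 = int r mod 12" unfolding d by simp
    then show ?thesis by (rule boundary_term_cong) (rule refl)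
  qed
  \<comment> \<open>The open interval has d - 1 = 12k + (r - 1) elements; r is at least 1 because d
    is odd.\<close>
  then have "(\<Sum>a\<in>{0<..<d}. boundary_term d a) = (\<Sum>i<12 * k + (r - 1). boundary_term (int r) (int i + 1))"
    using r by (intro sum.reindex_bij_witness[where i = "\<lambda>i. int i + 1" and j = "\<lambda>a. nat (a - 1)"])
      (auto simp: d)
  also have "\<dots> = int k * (\<Sum>i<12. boundary_term (int r) (int i + 1)) + (\<Sum>i<r - 1. boundary_term (int r) (int i + 1))"
  proof (rule sum_periodic)
    show "boundary_term (int r) (int (12 + i) + 1) = boundary_term (int r) (int i + 1)" for i
    proof -
      have "int (12 + i) + 1 = (int i + 1) + 12" by simp
      then have "(int (12 + i) + 1) mod 12 = (int i + 1) mod 12" by (simp only: mod_add_self2)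
      then show ?thesis by (rule boundary_term_cong[OF refl])
    qed
  qed
  also have "\<dots> = - 2 * chi12 (int r) + 2 * chi4 (int r) + 2 * kernel_b3 (int r)"
    using boundary_term_residues[THEN bspec, OF r] by (simp only: conv)
  finally have "(\<Sum>a\<in>{0<..<d}. boundary_term d a) = - 2 * chi12 (int r) + 2 * chi4 (int r) + 2 * kernel_b3 (int r)" .
  moreover have "chi12 (int r) = chi12 d" "chi4 (int r) = chi4 d"
    using chi_mod[of d] assms by (simp_all add: r_def)
  moreover have "kernel_b3 (int r) = kernel_b3 d"
    using chi_mod[of d] assms by (simp add: r_def kernel_b3_def mod_mod_cancel)
  ultimately show ?thesis by (simp only:)
qed

lemma divisor_sum_swap:
  assumes "n > 0"
  shows "divisor_sum f n = (\<Sum>d | 0 < d \<and> d dvd n. f (n div d))"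
  unfolding divisor_sum_def
  by (rule sum.reindex_bij_witness[where i = "\<lambda>d. n div d" and j = "\<lambda>d. n div d"])
     (use assms in \<open>auto simp: pos_imp_zdiv_pos_iff zdvd_imp_le div_dvd_iff_mult elim!: dvdE\<close>)

text \<open>\<open>chi4 n = -1\<close> gives complementary divisors opposite signs, so the sum
  equals its own negative. This removes a boundary term in \<open>kernel_convolution\<close> and the
  terms with 4 | c in the convolution of counts.\<close>

lemma divisor_sum_chi4_3:
  assumes "n > 0" "n mod 4 = 3"
  shows "divisor_sum chi4 n = 0"
proof -
  have "chi4 (n div d) = - chi4 d" if "0 < d" "d dvd n" for d
  proof -
    from that have n: "n = d * (n div d)" by simp
    have "chi4 n = -1" using assms by (simp add: chi4_def)
    then have "chi4 d * chi4 (n div d) = -1" using chi4_mult n by metis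
    moreover have "chi4 d \<in> {0,1,-1}" "chi4 (n div d) \<in> {0,1,-1}" by (auto simp: chi4_def)
    ultimately show ?thesis by auto
  qed
  then have "divisor_sum chi4 n = - divisor_sum chi4 n"
    by (subst divisor_sum_swap[OF assms(1)]) (simp add: divisor_sum_def sum_negf[symmetric])
  then show ?thesis by simp
qed

lemma divisor_sum_multiples:
  assumes "n > 0" "m > 0"
  shows "divisor_sum (\<lambda>d. if m dvd d then f d else 0) n =
    (if m dvd n then divisor_sum (\<lambda>d. f (m * d)) (n div m) else 0)"
proof (cases "m dvd n")
  case True
  then obtain k where k: "n = m * k" by blast
  have "divisor_sum (\<lambda>d. if m dvd d then f d else 0) n = (\<Sum>d | (0 < d \<and> d dvd n) \<and> m dvd d. f d)"
    unfolding divisor_sum_def using assms by (simp add: sum.inter_filter[symmetric])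
  also have "\<dots> = (\<Sum>d | 0 < d \<and> d dvd k. f (m * d))"
    by (rule sum.reindex_bij_witness[where i = "\<lambda>d. m * d" and j = "\<lambda>d. d div m"])
       (use assms in \<open>auto simp: k zero_less_mult_iff elim!: dvdE\<close>)
  finally show ?thesis using True k assms by (simp add: divisor_sum_def)
next
  case False
  then have "\<not> m dvd d" if "d dvd n" for d using that dvd_trans by blast
  then show ?thesis using False unfolding divisor_sum_def by simp
qed

text \<open>Liouville's identity for \<open>liouville_fun\<close>, with the left side averaged over
  the swap of \<open>a\<close> and \<open>b\<close> so that \<open>liouville_kernel\<close>
  applies.\<close>

lemma kernel_convolution:
  assumes "n > 0" "n mod 4 = 3"
  shows "(\<Sum>c\<in>{0<..<n}. divisor_sum kernel_a c * divisor_sum chi4 (n - c) + divisor_sum kernel_a3 c * divisor_sum kernel_b3 (n - c))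
    = - 2 * (\<Sum>d | 0 < d \<and> d dvd n. chi12 d * (n div d)) + 2 * divisor_sum kernel_b3 n"
proof -
  let ?T = "sol_sum n (\<lambda>_ _ _ _. True)"
  have "(\<Sum>c\<in>{0<..<n}. divisor_sum kernel_a c * divisor_sum chi4 (n - c) + divisor_sum kernel_a3 c * divisor_sum kernel_b3 (n - c)) = ?T kernel"
    unfolding kernel_def[abs_def] sol_sum_add sol_sum_convolution sum.distrib ..
  moreover have "2 * ?T liouville_term = - 2 * ?T kernel"
  proof -
    have "2 * ?T h = ?T (\<lambda>a b. h a b + h b a)" for h
      using sol_sum_swap[of n "\<lambda>_ _ _ _. True" h] by (simp add: sol_sum_add)
    moreover have "?T (\<lambda>a b. - (kernel a b + kernel b a)) = - ?T (\<lambda>a b. kernel a b + kernel b a)"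
      using sol_sum_diff[of n "\<lambda>_ _ _ _. True" "\<lambda>a b. 0" "\<lambda>a b. kernel a b + kernel b a"] by (simp add: sol_sum_def)
    ultimately show ?thesis by (simp add: liouville_kernel)
  qed
  \<comment> \<open>The diagonal gives \<open>2 * chi12 d * (n div d - 1)\<close>; its part
    \<open>- 2 * chi12 d\<close> cancels against the same term of the boundary sum.\<close>
  moreover have "?T liouville_term = (\<Sum>d | 0 < d \<and> d dvd n. 2 * (chi12 d * (n div d)) - 2 * chi4 d - 2 * kernel_b3 d)"
    unfolding liouville_term_sum[OF assms(1)] sum_subtractf[symmetric]
  proof (rule sum.cong[OF refl])
    fix d assume d: "d \<in> {d. 0 < d \<and> d dvd n}"
    have "odd n" using assms(2) by presburger
    then have "odd d" using d by (metis dvd_trans mem_Collect_eq)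
    then have r: "(\<Sum>a\<in>{0<..<d}. liouville_fun a (a - d) + liouville_fun d (d - a) + liouville_fun a d) = - 2 * chi12 d + 2 * chi4 d + 2 * kernel_b3 d"
      using boundary_term_sum[of d] d by (simp add: boundary_term_def)
    have "chi12 2 = 0" "chi12 3 = 0" "chi12 4 = 0" by (simp_all add: chi12_def chi3_def chi4_def)
    then have z: "chi12 (2 * d) = 0" "chi12 (3 * d) = 0" "chi12 (4 * d) = 0" by (simp_all add: chi12_mult)
    have "liouville_fun d 0 + liouville_fun 0 d + liouville_fun d d = 2 * chi12 d"
      using z by (simp add: liouville_fun_def)
    then show "(liouville_fun d 0 + liouville_fun 0 d + liouville_fun d d) * (n div d - 1) - (\<Sum>a\<in>{0<..<d}. liouville_fun a (a - d) + liouville_fun d (d - a) + liouville_fun a d) =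
        2 * (chi12 d * (n div d)) - 2 * chi4 d - 2 * kernel_b3 d"
      unfolding r by (simp add: algebra_simps)
  qed
  moreover have "\<dots> = 2 * (\<Sum>d | 0 < d \<and> d dvd n. chi12 d * (n div d)) - 2 * divisor_sum chi4 n - 2 * divisor_sum kernel_b3 n"
    by (simp add: sum_subtractf sum_distrib_left divisor_sum_def)
  ultimately show ?thesis using divisor_sum_chi4_3[OF assms] by simp
qed

section \<open>The quaternary forms as convolutions\<close>

lemma odd_square_eq: "odd (x::int) \<Longrightarrow> \<exists>k. x^2 = 8 * k + 1"
proof -
  assume "odd x"
  then obtain j where j: "x = 2 * j + 1" by (elim oddE)
  have "even (j * (j + 1))" by simp
  then obtain k where "j * (j + 1) = 2 * k" by (elim evenE)
  then have "x^2 = 8 * k + 1" unfolding j by (simp add: power2_eq_square algebra_simps)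
  then show ?thesis by blast
qed

lemma abs_le_square: "\<bar>x\<bar> \<le> (x::int)^2"
  using self_le_power[of "\<bar>x\<bar>" 2] by (cases "x = 0") auto

lemma finite_square_sum:
  fixes n :: int
  assumes "\<And>x y. P x y \<Longrightarrow> x^2 + y^2 \<le> n"
  shows "finite {(x::int, y::int). P x y}"
proof (rule finite_subset)
  show "{(x, y). P x y} \<subseteq> {-n..n} \<times> {-n..n}"
  proof
    fix z assume "z \<in> {(x, y). P x y}"
    then obtain x y where z: "z = (x, y)" and "x^2 + y^2 \<le> n" using assms by auto
    then show "z \<in> {-n..n} \<times> {-n..n}"
      using abs_le_square[of x] abs_le_square[of y] zero_le_power2[of x] zero_le_power2[of y]
      by (simp add: abs_le_iff)
  qed
qed simp

text \<open>Since both parts are even and nonnegative on admissible pairs, the first part is 2c with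
  c between 0 and n, and solutions are sorted by c.\<close>

lemma card_convolution:
  fixes f g :: "int \<Rightarrow> int \<Rightarrow> int"
  assumes f: "\<And>x y. P x y \<Longrightarrow> 0 \<le> f x y \<and> even (f x y)" and g: "\<And>z w. R z w \<Longrightarrow> 0 \<le> g z w \<and> even (g z w)"
    and fin: "\<And>m. finite {(x, y). P x y \<and> f x y = m}" "\<And>m. finite {(z, w). R z w \<and> g z w = m}"
  shows "card {(x, y, z, w). P x y \<and> R z w \<and> f x y + g z w = 2 * n} =
    (\<Sum>c\<in>{0..n}. card {(x, y). P x y \<and> f x y = 2 * c} * card {(z, w). R z w \<and> g z w = 2 * (n - c)})"
proof -
  let ?A = "\<lambda>c. {(x, y). P x y \<and> f x y = 2 * c}" and ?B = "\<lambda>c. {(z, w). R z w \<and> g z w = 2 * (n - c)}"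
  have "card {(x, y, z, w). P x y \<and> R z w \<and> f x y + g z w = 2 * n} = card (SIGMA c:{0..n}. ?A c \<times> ?B c)"
  proof (rule bij_betw_same_card, rule bij_betw_byWitness)
    let ?S = "{(x, y, z, w). P x y \<and> R z w \<and> f x y + g z w = 2 * n}" and ?T = "SIGMA c:{0..n}. ?A c \<times> ?B c"
    let ?h = "\<lambda>(x, y, z, w). (f x y div 2, (x, y), (z, w))" and ?k = "\<lambda>(c, (x, y), (z, w)). (x, y, z, w)"
    show "\<forall>s\<in>?S. ?k (?h s) = s" "\<forall>t\<in>?T. ?h (?k t) = t" "?k ` ?T \<subseteq> ?S" by auto
    show "?h ` ?S \<subseteq> ?T"
    proof
      fix t assume "t \<in> ?h ` ?S"
      then obtain x y z w where t: "t = (f x y div 2, (x, y), (z, w))" "P x y" "R z w" "f x y + g z w = 2 * n" by auto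
      then obtain c where c: "f x y = 2 * c" using f by (meson evenE)
      then show "t \<in> ?T" using t f[of x y] g[of z w] by auto
    qed
  qed
  also have "\<dots> = (\<Sum>c\<in>{0..n}. card (?A c \<times> ?B c))"
    by (rule card_SigmaI) (use fin in auto)
  finally show ?thesis by (simp add: card_cartesian_product)
qed

text \<open>For odd k the coordinates are not both even. Multiplication by the unit \<theta>, (p, q)
  to (-q, p + q), permutes the three remaining parity classes cyclically, so two thirds of the
  \<open>6 * divisor_sum chi3 k\<close> elements have odd q.\<close>

lemma card_eisenstein_odd:
  assumes "odd k" "k > 0"
  shows "int (card {(p, q) \<in> reps 1 k. odd q}) = 4 * divisor_sum chi3 k"
proof -
  have fin: "finite (reps 1 k)" by (rule finite_reps) simp
  let ?A = "{(p, q) \<in> reps 1 k. even q}" and ?B = "{(p, q) \<in> reps 1 k. even p \<and> odd q}" and ?C = "{(p, q) \<in> reps 1 k. odd p \<and> odd q}"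
  have par: "odd p \<or> odd q" if "(p, q) \<in> reps 1 k" for p q
    using that assms by (auto simp: reps_def)
  have rot: "(- q, p + q) \<in> reps 1 k" "(p + q, - p) \<in> reps 1 k" if "(p, q) \<in> reps 1 k" for p q
  proof -
    have "(- q)^2 + (- q) * (p + q) + (p + q)^2 = p^2 + p * q + q^2" "(p + q)^2 + (p + q) * (- p) + (- p)^2 = p^2 + p * q + q^2"
      by (simp_all add: power2_eq_square algebra_simps)
    then show "(- q, p + q) \<in> reps 1 k" "(p + q, - p) \<in> reps 1 k" using that by (simp_all add: reps_def)
  qed
  have 1: "card ?A = card ?B"
    by (rule card_eq_witness[where f = "\<lambda>(p, q). (- q, p + q)" and g = "\<lambda>(p, q). (p + q, - p)"]) (use rot par in auto)
  have 2: "card ?B = card ?C"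
    by (rule card_eq_witness[where f = "\<lambda>(p, q). (- q, p + q)" and g = "\<lambda>(p, q). (p + q, - p)"]) (use rot par in auto)
  have f: "finite ?A" "finite ?B" "finite ?C" by (rule finite_subset[OF _ fin]; auto)+
  have u: "{(p, q) \<in> reps 1 k. odd q} = ?B \<union> ?C" "reps 1 k = ?A \<union> {(p, q) \<in> reps 1 k. odd q}" by auto
  have c: "card {(p, q) \<in> reps 1 k. odd q} = card ?B + card ?C"
    unfolding u(1) by (rule card_Un_disjoint) (use f in auto)
  have "card (reps 1 k) = card ?A + card {(p, q) \<in> reps 1 k. odd q}"
    by (subst u(2), rule card_Un_disjoint) (use f u(1) in auto)
  moreover have "int (card (reps 1 k)) = 6 * divisor_sum chi3 k"
    using card_reps[of 1 k] assms by (simp add: norm_char_def)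
  ultimately show ?thesis using 1 2 c by simp
qed

text \<open>Odd squares are 1 modulo 8, which forces \<open>c mod 4 = 2\<close>. The substitution x
  = 2p + q, y = q turns the form into 4 (p^2 + pq + q^2) with q odd.\<close>

lemma card_odd_1_3:
  "int (card {(x, y). (odd x \<and> odd y) \<and> x^2 + 3 * y^2 = 2 * (c::int)}) =
    (if c > 0 \<and> c mod 4 = 2 then 4 * divisor_sum chi3 (c div 2) else 0)"
proof -
  have m: "c > 0 \<and> c mod 4 = 2" if xy: "odd x" "odd y" "x^2 + 3 * y^2 = 2 * c" for x y
  proof -
    obtain i where i: "x^2 = 8 * i + 1" using odd_square_eq[OF xy(1)] by blast
    obtain j where j: "y^2 = 8 * j + 1" using odd_square_eq[OF xy(2)] by blast
    have "x^2 \<ge> 0" "y^2 \<ge> 0" by simp_all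
    with i j xy(3) show ?thesis by presburger
  qed
  show ?thesis
  proof (cases "c > 0 \<and> c mod 4 = 2")
    case False
    then have "{(x, y). (odd x \<and> odd y) \<and> x^2 + 3 * y^2 = 2 * c} = {}" using m by auto
    then show ?thesis by (simp only: False if_False card.empty of_nat_0)
  next
    case True
    define k where "k = c div 2"
    have k: "c = 2 * k" "odd k" "k > 0" using True unfolding k_def by presburger+
    have "card {(x, y). (odd x \<and> odd y) \<and> x^2 + 3 * y^2 = 2 * c} = card {(p, q) \<in> reps 1 k. odd q}"
    proof (rule card_eq_witness[where f = "\<lambda>(x, y). ((x - y) div 2, y)" and g = "\<lambda>(p, q). (2 * p + q, q)"])
      fix s assume "s \<in> {(x, y). (odd x \<and> odd y) \<and> x^2 + 3 * y^2 = 2 * c}"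
      then obtain x y where s: "s = (x, y)" "odd x" "odd y" "x^2 + 3 * y^2 = 4 * k" using k by auto
      then have "even (x - y)" by simp
      then obtain p where p: "x = 2 * p + y" by (metis diff_add_cancel evenE)
      have "4 * (p^2 + p * y + y^2) = 4 * k" using s(4) unfolding p by (simp add: power2_eq_square algebra_simps)
      then show "(case s of (x, y) \<Rightarrow> ((x - y) div 2, y)) \<in> {(p, q) \<in> reps 1 k. odd q} \<and>
          (case case s of (x, y) \<Rightarrow> ((x - y) div 2, y) of (p, q) \<Rightarrow> (2 * p + q, q)) = s"
        using s(3) unfolding s(1) p by (simp add: reps_def)
    next
      fix s assume "s \<in> {(p, q) \<in> reps 1 k. odd q}"
      then obtain p q where s: "s = (p, q)" "odd q" "p^2 + p * q + q^2 = k" by (auto simp: reps_def)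
      have "(2 * p + q)^2 + 3 * q^2 = 4 * (p^2 + p * q + q^2)" by (simp add: power2_eq_square algebra_simps)
      then show "(case s of (p, q) \<Rightarrow> (2 * p + q, q)) \<in> {(x, y). (odd x \<and> odd y) \<and> x^2 + 3 * y^2 = 2 * c} \<and>
          (case case s of (p, q) \<Rightarrow> (2 * p + q, q) of (x, y) \<Rightarrow> ((x - y) div 2, y)) = s"
        using s k by simp
    qed
    then show ?thesis using card_eisenstein_odd[OF k(2,3)] True by (simp add: k_def)
  qed
qed

text \<open>For odd e two even squares cannot add up to 2e, so the parity condition holds for every
  representation, and \<open>reps_two\<close> removes the factor 2.\<close>

lemma card_odd_1_1:
  "int (card {(x, y). (odd x \<and> odd y) \<and> x^2 + y^2 = 2 * (e::int)}) =
    (if e > 0 \<and> odd e then 4 * divisor_sum chi4 e else 0)"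
proof -
  have m: "e > 0 \<and> odd e" if xy: "odd x" "odd y" "x^2 + y^2 = 2 * e" for x y
  proof -
    obtain i where i: "x^2 = 8 * i + 1" using odd_square_eq[OF xy(1)] by blast
    obtain j where j: "y^2 = 8 * j + 1" using odd_square_eq[OF xy(2)] by blast
    have "x^2 \<ge> 0" "y^2 \<ge> 0" by simp_all
    with i j xy(3) show ?thesis by presburger
  qed
  show ?thesis
  proof (cases "e > 0 \<and> odd e")
    case False
    then have "{(x, y). (odd x \<and> odd y) \<and> x^2 + y^2 = 2 * e} = {}" using m by auto
    then show ?thesis by (simp only: False if_False card.empty of_nat_0)
  next
    case True
    have "odd x \<and> odd y" if "x^2 + y^2 = 2 * e" for x y
    proof (rule ccontr)
      assume "\<not> ?thesis"
      moreover have "even (x^2 + y^2)" using that by simp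
      ultimately have "even x" "even y" by auto
      then obtain i j where "x = 2 * i" "y = 2 * j" by (elim evenE)
      then have "e = 2 * (i^2 + j^2)" using that by (simp add: power2_eq_square)
      then show False using True by simp
    qed
    then have "{(x, y). (odd x \<and> odd y) \<and> x^2 + y^2 = 2 * e} = reps 0 (2 * e)" by (auto simp: reps_def)
    then show ?thesis using True reps_two[of e] card_reps[of 0 e] by (simp add: norm_char_def)
  qed
qed

lemma card_8_eisenstein:
  "int (card {(u, v). True \<and> 8 * (u^2 + u * v + v^2) = 2 * (c::int)}) =
    (if c = 0 then 1 else if c > 0 \<and> 4 dvd c then 6 * divisor_sum chi3 (c div 4) else 0)"
proof (cases "4 dvd c")
  case True
  then obtain k where k: "c = 4 * k" by blast
  then have e: "{(u, v). True \<and> 8 * (u^2 + u * v + v^2) = 2 * c} = reps 1 k" by (auto simp: reps_def)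
  have bd: "\<bar>u\<bar> \<le> 2 * k" "\<bar>v\<bar> \<le> 2 * k" if "(u, v) \<in> reps 1 k" for u v
    using that reps_bound[where e = 1 and x = u and y = v] by (simp_all add: reps_def)
  consider "k = 0" | "k < 0" | "k > 0" by linarith
  then show ?thesis
  proof cases
    case 1
    have "(u, v) = (0, 0)" if "(u, v) \<in> reps 1 k" for u v using bd[OF that] 1 by simp
    moreover have "(0, 0) \<in> reps 1 k" using 1 by (simp add: reps_def)
    ultimately have "reps 1 k = {(0, 0)}" by auto
    then show ?thesis unfolding e using 1 k by simp
  next
    case 2
    have False if "(u, v) \<in> reps 1 k" for u v using bd(1)[OF that] 2 by simp
    then have "reps 1 k = {}" by auto
    then show ?thesis unfolding e using 2 k by simp
  next
    case 3
    then show ?thesis unfolding e using card_reps[of 1 k] k by (simp add: norm_char_def)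
  qed
next
  case False
  have "4 dvd c" if "8 * (u^2 + u * v + v^2) = 2 * c" for u v :: int
  proof -
    have "c = 4 * (u^2 + u * v + v^2)" using that by simp
    then show ?thesis by simp
  qed
  then have "{(u, v). True \<and> 8 * (u^2 + u * v + v^2) = 2 * c} = {}" using False by auto
  then have "card {(u, v). True \<and> 8 * (u^2 + u * v + v^2) = 2 * c} = 0" by (simp only: card.empty)
  then show ?thesis using False by auto
qed

lemma card_odd_3_3:
  "int (card {(x, y). (odd x \<and> odd y) \<and> 3 * (x^2 + y^2) = 2 * (e::int)}) =
    (if e > 0 \<and> odd e \<and> 3 dvd e then 4 * divisor_sum chi4 (e div 3) else 0)"
proof (cases "3 dvd e")
  case True
  then obtain k where k: "e = 3 * k" by blast
  then have e: "{(x, y). (odd x \<and> odd y) \<and> 3 * (x^2 + y^2) = 2 * e} = {(x, y). (odd x \<and> odd y) \<and> x^2 + y^2 = 2 * k}" by auto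
  then show ?thesis using card_odd_1_1[of k] k by (auto simp: zero_less_mult_iff)
next
  case False
  have "3 dvd e" if "3 * (x^2 + y^2) = 2 * e" for x y :: int using that by presburger
  then have "{(x, y). (odd x \<and> odd y) \<and> 3 * (x^2 + y^2) = 2 * e} = {}" using False by auto
  then have "card {(x, y). (odd x \<and> odd y) \<and> 3 * (x^2 + y^2) = 2 * e} = 0" by (simp only: card.empty)
  then show ?thesis using False by auto
qed

section \<open>The two quaternary counts and their difference\<close>

definition odd_reps_1311 :: "int \<Rightarrow> (int \<times> int \<times> int \<times> int) set" where
  "odd_reps_1311 n = {(x, y, z, w). (odd x \<and> odd y) \<and> (odd z \<and> odd w) \<and> x^2 + 3 * y^2 + (z^2 + w^2) = 2 * n}"

text \<open>The form obtained by splitting (x, z, w) along (1, 1, 1) and its orthogonal complement,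
  see \<open>card_balanced_reps\<close>. \<open>True\<close> stands in the place of the side
  condition on the first pair in \<open>card_convolution\<close>.\<close>

definition eisenstein_reps :: "int \<Rightarrow> (int \<times> int \<times> int \<times> int) set" where
  "eisenstein_reps n = {(u, v, s, t). True \<and> (odd s \<and> odd t) \<and> 8 * (u^2 + u * v + v^2) + 3 * (s^2 + t^2) = 2 * n}"

lemma norm_nonneg: "0 \<le> (u::int)^2 + u * v + v^2"
proof -
  have "0 \<le> (u + v)^2 + u^2 + v^2" by simp
  then show ?thesis by (simp add: power2_eq_square algebra_simps)
qed

lemma card_odd_reps_1311:
  "int (card (odd_reps_1311 n)) = (\<Sum>c\<in>{0..n}.
     int (card {(x, y). (odd x \<and> odd y) \<and> x^2 + 3 * y^2 = 2 * c}) *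
     int (card {(x, y). (odd x \<and> odd y) \<and> x^2 + y^2 = 2 * (n - c)}))"
proof -
  have "card (odd_reps_1311 n) = (\<Sum>c\<in>{0..n}. card {(x, y). (odd x \<and> odd y) \<and> x^2 + 3 * y^2 = 2 * c} *
     card {(x, y). (odd x \<and> odd y) \<and> x^2 + y^2 = 2 * (n - c)})"
    unfolding odd_reps_1311_def
  proof (rule card_convolution)
    show "finite {(x, y). (odd x \<and> odd y) \<and> x^2 + 3 * y^2 = m}" for m :: int
    proof (rule finite_square_sum)
      show "x^2 + y^2 \<le> m" if "(odd x \<and> odd y) \<and> x^2 + 3 * y^2 = m" for x y :: int
        using that zero_le_power2[of y] by linarith
    qed
    show "finite {(x, y). (odd x \<and> odd y) \<and> x^2 + y^2 = m}" for m :: int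
      by (rule finite_square_sum[where n = m]) simp
  qed auto
  then show ?thesis by simp
qed

lemma card_eisenstein_reps:
  "int (card (eisenstein_reps n)) = (\<Sum>c\<in>{0..n}.
     int (card {(u, v). True \<and> 8 * (u^2 + u * v + v^2) = 2 * c}) *
     int (card {(x, y). (odd x \<and> odd y) \<and> 3 * (x^2 + y^2) = 2 * (n - c)}))"
proof -
  have "card (eisenstein_reps n) = (\<Sum>c\<in>{0..n}. card {(u, v). True \<and> 8 * (u^2 + u * v + v^2) = 2 * c} *
     card {(x, y). (odd x \<and> odd y) \<and> 3 * (x^2 + y^2) = 2 * (n - c)})"
    unfolding eisenstein_reps_def
  proof (rule card_convolution)
    show "finite {(u, v). True \<and> 8 * (u^2 + u * v + v^2) = m}" for m :: int
    proof (rule finite_square_sum)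
      show "u^2 + v^2 \<le> m" if "True \<and> 8 * (u^2 + u * v + v^2) = m" for u v :: int
      proof -
        have "0 \<le> (u + v)^2" by simp
        then have "u^2 + v^2 \<le> 2 * (u^2 + u * v + v^2)" by (simp add: power2_eq_square algebra_simps)
        moreover have "2 * Q \<le> m" if "8 * Q = m" "0 \<le> Q" for Q using that by linarith
        ultimately show ?thesis using conjunct2[OF that] norm_nonneg[of u v] order_trans by blast
      qed
    qed
    show "finite {(x, y). (odd x \<and> odd y) \<and> 3 * (x^2 + y^2) = m}" for m :: int
    proof (rule finite_square_sum)
      show "x^2 + y^2 \<le> m" if "(odd x \<and> odd y) \<and> 3 * (x^2 + y^2) = m" for x y :: int
      proof -
        have bound: "A \<le> m" if "3 * A = m" "0 \<le> A" for A using that by linarith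
        show ?thesis by (rule bound[OF conjunct2[OF that]]) simp
      qed
    qed
  qed (auto simp: norm_nonneg simp del: distrib_left_numeral)
  then show ?thesis by simp
qed

lemma divisor_sum_cong: "(\<And>d. 0 < d \<Longrightarrow> d dvd n \<Longrightarrow> f d = g d) \<Longrightarrow> divisor_sum f n = divisor_sum g n"
  unfolding divisor_sum_def by (rule sum.cong) auto

lemma divisor_sum_cmult: "divisor_sum (\<lambda>d. k * f d) n = k * divisor_sum f n"
  unfolding divisor_sum_def by (simp add: sum_distrib_left)

lemma divisor_sum_kernel_a:
  assumes "c > 0"
  shows "odd c \<Longrightarrow> divisor_sum kernel_a c = 0"
    and "c mod 4 = 2 \<Longrightarrow> divisor_sum kernel_a c = - 8 * divisor_sum chi3 (c div 2)"
proof -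
  have "kernel_a = (\<lambda>d. if 2 dvd d then kernel_a d else 0)"
  proof
    fix d :: int
    have "d mod 4 \<noteq> 2 \<and> d mod 4 \<noteq> 0" if "\<not> 2 dvd d" using that by presburger
    then show "kernel_a d = (if 2 dvd d then kernel_a d else 0)" by (auto simp: kernel_a_def)
  qed
  then have *: "divisor_sum kernel_a c = (if 2 dvd c then divisor_sum (\<lambda>d. kernel_a (2 * d)) (c div 2) else 0)"
    using divisor_sum_multiples[of c 2 kernel_a] assms by simp
  then show "odd c \<Longrightarrow> divisor_sum kernel_a c = 0" by simp
  assume c: "c mod 4 = 2"
  have "kernel_a (2 * d) = - 8 * chi3 d" if "d dvd c div 2" for d
  proof -
    have "odd (c div 2)" using c by presburger
    then have "odd d" using that dvd_trans by blast
    then have "(2 * d) mod 4 = 2" by presburger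
    moreover have "chi3 2 = -1" by (simp add: chi3_def)
    ultimately show ?thesis by (simp add: kernel_a_def chi3_mult)
  qed
  then have "divisor_sum (\<lambda>d. kernel_a (2 * d)) (c div 2) = divisor_sum (\<lambda>d. - 8 * chi3 d) (c div 2)"
    by (intro divisor_sum_cong)
  moreover have "2 dvd c" using c by presburger
  ultimately show "divisor_sum kernel_a c = - 8 * divisor_sum chi3 (c div 2)"
    using * by (simp only: if_True divisor_sum_cmult)
qed

lemma divisor_sum_kernel_a3:
  assumes "c > 0"
  shows "divisor_sum kernel_a3 c = (if 4 dvd c then - 12 * divisor_sum chi3 (c div 4) else 0)"
proof -
  have e: "kernel_a3 = (\<lambda>d. if 4 dvd d then - 12 * chi3 d else 0)" by (auto simp: kernel_a3_def dvd_eq_mod_eq_0)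
  have "chi3 4 = 1" by (simp add: chi3_def)
  then have "(\<lambda>d. - 12 * chi3 (4 * d)) = (\<lambda>d. - 12 * chi3 d)" by (simp add: chi3_mult)
  then show ?thesis unfolding e using divisor_sum_multiples[of c 4 "\<lambda>d. - 12 * chi3 d"] assms
    by (simp only: divisor_sum_cmult)
qed

lemma divisor_sum_kernel_b3:
  assumes "c > 0"
  shows "divisor_sum kernel_b3 c = (if 3 dvd c then - divisor_sum chi4 (c div 3) else 0)"
proof -
  have e: "kernel_b3 = (\<lambda>d. if 3 dvd d then chi4 d else 0)" by (auto simp: kernel_b3_def dvd_eq_mod_eq_0)
  have "chi4 3 = -1" by (simp add: chi4_def)
  then have "(\<lambda>d. chi4 (3 * d)) = (\<lambda>d. - 1 * chi4 d)" by (simp add: chi4_mult)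
  then show ?thesis unfolding e using divisor_sum_multiples[of c 3 chi4] assms
    by (simp only: divisor_sum_cmult) simp
qed

text \<open>For 0 < c < n the two convolutions are -2 and 2 times the products forming
  \<open>kernel\<close>, term by term, so \<open>kernel_convolution\<close> evaluates the
  difference. Of the end terms only \<open>c = 0\<close> of the Eisenstein form survives, and it
  cancels the remaining \<open>divisor_sum kernel_b3 n\<close>.\<close>

lemma card_odd_minus_eisenstein_reps:
  assumes "n > 0" "n mod 4 = 3"
  shows "int (card (odd_reps_1311 n)) - int (card (eisenstein_reps n)) = 4 * (\<Sum>d | 0 < d \<and> d dvd n. chi12 d * (n div d))"
proof -
  let ?F1 = "\<lambda>c::int. int (card {(x, y). (odd x \<and> odd y) \<and> x^2 + 3 * y^2 = 2 * c})"
  let ?F2 = "\<lambda>c::int. int (card {(x, y). (odd x \<and> odd y) \<and> x^2 + y^2 = 2 * c})"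
  let ?F3 = "\<lambda>c::int. int (card {(u, v). True \<and> 8 * (u^2 + u * v + v^2) = 2 * c})"
  let ?F4 = "\<lambda>c::int. int (card {(x, y). (odd x \<and> odd y) \<and> 3 * (x^2 + y^2) = 2 * c})"
  have "odd n" using assms(2) by presburger
  have ends: "sum h {0..n} = h 0 + sum h {0<..<n} + h n" for h :: "int \<Rightarrow> int"
  proof -
    have "{0..n} = insert 0 (insert n {0<..<n})" using assms by auto
    then show ?thesis using assms by simp
  qed
  have t1: "?F1 c * ?F2 (n - c) = - 2 * (divisor_sum kernel_a c * divisor_sum chi4 (n - c))" if c: "c \<in> {0<..<n}" for c
  proof -
    have c0: "c > 0" "n - c > 0" using c by auto
    have "odd c \<or> c mod 4 = 2 \<or> c mod 4 = 0" by presburger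
    then consider "odd c" | "c mod 4 = 2" | "c mod 4 = 0" by blast
    then show ?thesis
    proof cases
      case 1
      then have "\<not> (c > 0 \<and> c mod 4 = 2)" by presburger
      then show ?thesis using divisor_sum_kernel_a(1)[OF c0(1) 1] by (simp only: card_odd_1_3 if_False)
    next
      case 2
      then have "odd (n - c)" using \<open>odd n\<close> by presburger
      then show ?thesis unfolding card_odd_1_3 card_odd_1_1 divisor_sum_kernel_a(2)[OF c0(1) 2] using 2 c0 by simp
    next
      \<comment> \<open>The left side vanishes by parity, the right side because
        \<open>n - c\<close> is 3 modulo 4.\<close>
      case 3
      then have "\<not> (c > 0 \<and> c mod 4 = 2)" "(n - c) mod 4 = 3" using assms(2) by presburger+
      then show ?thesis using divisor_sum_chi4_3[OF c0(2)] by (simp only: card_odd_1_3 if_False)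
    qed
  qed
  have t2: "?F3 c * ?F4 (n - c) = 2 * (divisor_sum kernel_a3 c * divisor_sum kernel_b3 (n - c))" if c: "c \<in> {0<..<n}" for c
  proof -
    have c0: "c > 0" "n - c > 0" using c by auto
    show ?thesis
    proof (cases "4 dvd c")
      case True
      then have "odd (n - c)" using \<open>odd n\<close> by presburger
      then show ?thesis
        unfolding card_8_eisenstein card_odd_3_3 divisor_sum_kernel_a3[OF c0(1)] divisor_sum_kernel_b3[OF c0(2)]
        using True c0 by simp
    next
      case False
      then show ?thesis unfolding card_8_eisenstein divisor_sum_kernel_a3[OF c0(1)] using c0 by simp
    qed
  qed
  \<comment> \<open>The value 1 of \<open>?F3 0\<close> is the pair u = v = 0.\<close>
  have b: "?F1 0 = 0" "?F2 0 = 0" "?F4 0 = 0" "?F3 0 = 1" "?F4 n = - 4 * divisor_sum kernel_b3 n"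
    using assms(1) \<open>odd n\<close> by (simp_all only: card_odd_1_3 card_odd_1_1 card_odd_3_3 card_8_eisenstein divisor_sum_kernel_b3[OF assms(1)]) simp_all
  have s: "(\<Sum>c\<in>{0<..<n}. ?F1 c * ?F2 (n - c)) = (\<Sum>c\<in>{0<..<n}. - 2 * (divisor_sum kernel_a c * divisor_sum chi4 (n - c)))"
    "(\<Sum>c\<in>{0<..<n}. ?F3 c * ?F4 (n - c)) = (\<Sum>c\<in>{0<..<n}. 2 * (divisor_sum kernel_a3 c * divisor_sum kernel_b3 (n - c)))"
    by (rule sum.cong[OF refl t1], assumption) (rule sum.cong[OF refl t2])
  have T: "int (card (odd_reps_1311 n)) = (\<Sum>c\<in>{0<..<n}. - 2 * (divisor_sum kernel_a c * divisor_sum chi4 (n - c)))"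
    and D: "int (card (eisenstein_reps n)) = - 4 * divisor_sum kernel_b3 n + (\<Sum>c\<in>{0<..<n}. 2 * (divisor_sum kernel_a3 c * divisor_sum kernel_b3 (n - c)))"
    unfolding card_odd_reps_1311 card_eisenstein_reps ends s diff_zero diff_self b by simp_all
  have "int (card (odd_reps_1311 n)) - int (card (eisenstein_reps n)) = - 2 * (\<Sum>c\<in>{0<..<n}.
      divisor_sum kernel_a c * divisor_sum chi4 (n - c) + divisor_sum kernel_a3 c * divisor_sum kernel_b3 (n - c)) + 4 * divisor_sum kernel_b3 n"
    unfolding T D sum_distrib_left[symmetric] sum.distrib by (simp add: algebra_simps)
  then show ?thesis unfolding kernel_convolution[OF assms] by simp
qed

section \<open>Relations modulo 3\<close>

lemma square_mod_3: "(x::int)^2 mod 3 = (if 3 dvd x then 0 else 1)"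
proof -
  have m: "x^2 mod 3 = (x mod 3)^2 mod 3" by (simp add: power_mod)
  have "x mod 3 = 0 \<or> x mod 3 = 1 \<or> x mod 3 = 2" by presburger
  then show ?thesis unfolding m dvd_eq_mod_eq_0 by (elim disjE) simp_all
qed

lemma mod_3_add: "((x::int) + z + w) mod 3 = (x mod 3 + z mod 3 + w mod 3) mod 3"
  by (metis mod_add_eq mod_add_left_eq)

lemma three_squares_mod_3:
  fixes x y z w n :: int
  assumes "x^2 + 3 * y^2 + (z^2 + w^2) = 2 * n"
  shows "((if 3 dvd x then 0 else 1) + (if 3 dvd z then 0 else 1) + (if 3 dvd w then 0 else 1 :: int)) mod 3 = (2 * n) mod 3"
proof -
  have "(2 * n) mod 3 = (x^2 + z^2 + w^2 + y^2 * 3) mod 3" using assms by (simp add: algebra_simps)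
  also have "\<dots> = (x^2 + z^2 + w^2) mod 3" by (simp only: mod_mult_self1)
  also have "\<dots> = (x^2 mod 3 + z^2 mod 3 + w^2 mod 3) mod 3" by (rule mod_3_add)
  finally show ?thesis unfolding square_mod_3 ..
qed

lemma three_dvd_sum: "3 dvd (x::int) + z + w \<longleftrightarrow> (x mod 3 + z mod 3 + w mod 3) mod 3 = 0"
  unfolding dvd_eq_mod_eq_0 mod_3_add[of x z w] ..

lemma mod3_nonzero: "\<not> 3 dvd (x::int) \<Longrightarrow> x mod 3 = 1 \<and> (-x) mod 3 = 2 \<or> x mod 3 = 2 \<and> (-x) mod 3 = 1"
  by presburger

lemma mod3_zero: "3 dvd (x::int) \<Longrightarrow> x mod 3 = 0 \<and> (-x) mod 3 = 0"
  by presburger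

lemma finite_odd_reps_1311: "finite (odd_reps_1311 n)"
proof (rule finite_subset)
  show "odd_reps_1311 n \<subseteq> {-2*n..2*n} \<times> {-2*n..2*n} \<times> {-2*n..2*n} \<times> {-2*n..2*n}"
  proof
    fix s assume "s \<in> odd_reps_1311 n"
    then obtain x y z w where s: "s = (x, y, z, w)" and e: "x^2 + 3 * y^2 + (z^2 + w^2) = 2 * n" by (auto simp: odd_reps_1311_def)
    have "\<bar>x\<bar> \<le> 2 * n" "\<bar>y\<bar> \<le> 2 * n" "\<bar>z\<bar> \<le> 2 * n" "\<bar>w\<bar> \<le> 2 * n"
      using abs_le_square[of x] abs_le_square[of y] abs_le_square[of z] abs_le_square[of w] e
        zero_le_power2[of x] zero_le_power2[of y] zero_le_power2[of z] zero_le_power2[of w] by linarith+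
    then show "s \<in> {-2*n..2*n} \<times> {-2*n..2*n} \<times> {-2*n..2*n} \<times> {-2*n..2*n}" unfolding s by (simp add: abs_le_iff)
  qed
qed simp

lemma card_involution:
  assumes fin: "finite S" and f: "\<And>s. s \<in> S \<Longrightarrow> f s \<in> S \<and> f (f s) = s \<and> (P (f s) \<longleftrightarrow> \<not> P s)"
  shows "card S = 2 * card {s \<in> S. P s}"
proof -
  have "card {s \<in> S. P s} = card {s \<in> S. \<not> P s}"
    by (rule card_eq_witness[where f = f and g = f]) (use f in auto)
  moreover have "card S = card {s \<in> S. P s} + card {s \<in> S. \<not> P s}"
    using fin by (subst card_Un_disjoint[symmetric]) (auto intro: arg_cong[where f = card])
  ultimately show ?thesis by simp
qed

definition balanced_reps :: "int \<Rightarrow> (int \<times> int \<times> int \<times> int) set" where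
  "balanced_reps n = {s \<in> odd_reps_1311 n. case s of (x, y, z, w) \<Rightarrow> 3 dvd x + z + w}"

text \<open>(x, z, w) is written as its mean s plus deviations 2u, 2v, -2u - 2v, so that x^2 + z^2 +
  w^2 = 3s^2 + 8 (u^2 + uv + v^2). The balance condition makes the mean integral; it is odd, so the
  deviations are even.\<close>

lemma card_balanced_reps: "card (balanced_reps n) = card (eisenstein_reps n)"
proof (rule card_eq_witness[where
    f = "\<lambda>(x, y, z, w). ((x - (x + z + w) div 3) div 2, (z - (x + z + w) div 3) div 2, (x + z + w) div 3, y)" and
    g = "\<lambda>(u, v, s, t). (s + 2 * u, t, s + 2 * v, s - 2 * u - 2 * v)"])
  let ?f = "\<lambda>(x, y, z, w). ((x - (x + z + w) div 3) div 2, (z - (x + z + w) div 3) div 2, (x + z + w) div 3, y)"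
  let ?g = "\<lambda>(u, v, s, t). (s + 2 * u, t, s + 2 * v, s - 2 * u - 2 * v) :: int \<times> int \<times> int \<times> int"
  fix r assume "r \<in> balanced_reps n"
  then obtain x y z w where r: "r = (x, y, z, w)" "odd x" "odd y" "odd z" "odd w"
    "x^2 + 3 * y^2 + (z^2 + w^2) = 2 * n" "3 dvd x + z + w" by (auto simp: balanced_reps_def odd_reps_1311_def)
  then obtain s where s: "x + z + w = 3 * s" by blast
  have "odd (3 * s)" unfolding s[symmetric] using r by simp
  then have os: "odd s" by simp
  then have "even (x - s)" "even (z - s)" using r by simp_all
  then obtain u v where uv: "x = s + 2 * u" "z = s + 2 * v" by (metis add.commute diff_add_cancel evenE)
  have w: "w = s - 2 * u - 2 * v" using s uv by simp
  have "3 * s^2 + 8 * (u^2 + u * v + v^2) = x^2 + z^2 + w^2"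
    unfolding uv w by (simp add: power2_eq_square algebra_simps)
  then have e: "8 * (u^2 + u * v + v^2) + 3 * (s^2 + y^2) = 2 * n" using r(6) by simp
  have f: "?f r = (u, v, s, y)" unfolding r(1) prod.case s by (simp add: uv)
  show "?f r \<in> eisenstein_reps n \<and> ?g (?f r) = r" unfolding f using e os r(3) uv w r(1) by (simp add: eisenstein_reps_def)
next
  let ?f = "\<lambda>(x, y, z, w). ((x - (x + z + w) div 3) div 2, (z - (x + z + w) div 3) div 2, (x + z + w) div 3, y)"
  let ?g = "\<lambda>(u, v, s, t). (s + 2 * u, t, s + 2 * v, s - 2 * u - 2 * v) :: int \<times> int \<times> int \<times> int"
  fix r assume "r \<in> eisenstein_reps n"
  then obtain u v s t where r: "r = (u, v, s, t)" "odd s" "odd t" "8 * (u^2 + u * v + v^2) + 3 * (s^2 + t^2) = 2 * n"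
    by (auto simp: eisenstein_reps_def)
  have "(s + 2 * u)^2 + 3 * t^2 + ((s + 2 * v)^2 + (s - 2 * u - 2 * v)^2) = 8 * (u^2 + u * v + v^2) + 3 * (s^2 + t^2)"
    by (simp add: power2_eq_square algebra_simps)
  moreover have "s + 2 * u + (s + 2 * v) + (s - 2 * u - 2 * v) = 3 * s" by simp
  ultimately show "?g r \<in> balanced_reps n \<and> ?f (?g r) = r"
    unfolding r(1) balanced_reps_def odd_reps_1311_def using r(2-4) by simp
qed

text \<open>This companion of \<open>chi12_sum\<close>, weighted by the complementary divisor, is
  what Liouville's method delivers. It retains the powers of 3 in n: see
  \<open>chi12_cosum_3\<close>.\<close>

definition chi12_cosum :: "int \<Rightarrow> int" where
  "chi12_cosum n = (\<Sum>d | 0 < d \<and> d dvd n. chi12 d * (n div d))"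

lemma card_odd_minus_balanced_reps:
  assumes "n > 0" "n mod 4 = 3"
  shows "int (card (odd_reps_1311 n)) - int (card (balanced_reps n)) = 4 * chi12_cosum n"
  using card_odd_minus_eisenstein_reps[OF assms] by (simp add: card_balanced_reps chi12_cosum_def)

text \<open>Exactly one of x, z, w is a multiple of 3, and balance means that the other two are
  opposite modulo 3. Negating one of these toggles the condition.\<close>

lemma card_odd_reps_1311_eq_twice_balanced:
  assumes n: "n mod 3 = 1"
  shows "card (odd_reps_1311 n) = 2 * card (balanced_reps n)"
  unfolding balanced_reps_def
proof (rule card_involution[OF finite_odd_reps_1311, where f = "\<lambda>(x, y, z, w). if 3 dvd x then (x, y, -z, w) else (-x, y, z, w)"])
  fix s assume "s \<in> odd_reps_1311 n"
  then obtain x y z w where s: "s = (x, y, z, w)" "odd x" "odd y" "odd z" "odd w"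
    and e: "x^2 + 3 * y^2 + (z^2 + w^2) = 2 * n" by (auto simp: odd_reps_1311_def)
  have "(2 * n) mod 3 = 2" using n by presburger
  with three_squares_mod_3[OF e]
  have c: "3 dvd x \<and> \<not> 3 dvd z \<and> \<not> 3 dvd w \<or> \<not> 3 dvd x \<and> 3 dvd z \<and> \<not> 3 dvd w \<or> \<not> 3 dvd x \<and> \<not> 3 dvd z \<and> 3 dvd w"
    by (simp split: if_splits)
  have "(if 3 dvd x then 3 dvd x + (- z) + w else 3 dvd (- x) + z + w) \<longleftrightarrow> \<not> 3 dvd x + z + w"
    unfolding three_dvd_sum using c mod3_nonzero[of x] mod3_nonzero[of z] mod3_nonzero[of w] mod3_zero[of x] mod3_zero[of z] mod3_zero[of w]
    by (elim disjE conjE) auto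
  then show "(case s of (x, y, z, w) \<Rightarrow> if 3 dvd x then (x, y, -z, w) else (-x, y, z, w)) \<in> odd_reps_1311 n \<and>
      (case case s of (x, y, z, w) \<Rightarrow> if 3 dvd x then (x, y, -z, w) else (-x, y, z, w) of
         (x, y, z, w) \<Rightarrow> if 3 dvd x then (x, y, -z, w) else (-x, y, z, w)) = s \<and>
      ((case case s of (x, y, z, w) \<Rightarrow> if 3 dvd x then (x, y, -z, w) else (-x, y, z, w) of
         (x, y, z, w) \<Rightarrow> 3 dvd x + z + w) \<longleftrightarrow> \<not> (case s of (x, y, z, w) \<Rightarrow> 3 dvd x + z + w))"
    using s e by (cases "3 dvd x") (simp_all add: odd_reps_1311_def)
qed

text \<open>Here exactly two of x, z, w are multiples of 3, so their sum is not.\<close>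

lemma balanced_reps_empty:
  assumes n: "n mod 3 = 2"
  shows "balanced_reps n = {}"
proof -
  have False if s: "s \<in> balanced_reps n" for s
  proof -
    obtain x y z w where e: "x^2 + 3 * y^2 + (z^2 + w^2) = 2 * n" and d: "3 dvd x + z + w"
      using s by (auto simp: balanced_reps_def odd_reps_1311_def)
    have "(2 * n) mod 3 = 1" using n by presburger
    with three_squares_mod_3[OF e]
    have c: "\<not> 3 dvd x \<and> 3 dvd z \<and> 3 dvd w \<or> 3 dvd x \<and> \<not> 3 dvd z \<and> 3 dvd w \<or> 3 dvd x \<and> 3 dvd z \<and> \<not> 3 dvd w"
      by (simp split: if_splits)
    then show False using d by presburger
  qed
  then show ?thesis by blast
qed


definition odd_reps_3133 :: "int \<Rightarrow> (int \<times> int \<times> int \<times> int) set" where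
  "odd_reps_3133 m = {(x, y, z, w). (odd x \<and> odd y) \<and> (odd z \<and> odd w) \<and> 3 * x^2 + y^2 + 3 * (z^2 + w^2) = 2 * m}"

lemma odd_reps_1311_multiple_of_3:
  assumes "(x, y, z, w) \<in> odd_reps_1311 (3 * m)"
  shows "3 dvd x \<and> 3 dvd z \<and> 3 dvd w \<or> \<not> 3 dvd x \<and> \<not> 3 dvd z \<and> \<not> 3 dvd w"
proof -
  have "(2 * (3 * m)) mod 3 = 0" by presburger
  moreover have e: "x^2 + 3 * y^2 + (z^2 + w^2) = 2 * (3 * m)" using assms by (simp add: odd_reps_1311_def)
  ultimately show ?thesis using three_squares_mod_3[OF e] by (simp split: if_splits)
qed

lemma card_odd_reps_3133: "card {(x, y, z, w) \<in> odd_reps_1311 (3 * m). 3 dvd x} = card (odd_reps_3133 m)"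
proof (rule card_eq_witness[where f = "\<lambda>(x, y, z, w). (x div 3, y, z div 3, w div 3)" and g = "\<lambda>(x, y, z, w). (3 * x, y, 3 * z, 3 * w)"])
  fix s assume "s \<in> {(x, y, z, w) \<in> odd_reps_1311 (3 * m). 3 dvd x}"
  then obtain x y z w where s: "s = (x, y, z, w)" and t: "(x, y, z, w) \<in> odd_reps_1311 (3 * m)" and x: "3 dvd x" by auto
  have "3 dvd z" "3 dvd w" using odd_reps_1311_multiple_of_3[OF t] x by auto
  with x obtain a b c where abc: "x = 3 * a" "z = 3 * b" "w = 3 * c" by (elim dvdE)
  have "3 * (3 * a^2 + y^2 + 3 * (b^2 + c^2)) = 3 * (2 * m)"
    using t unfolding abc by (simp add: odd_reps_1311_def power2_eq_square)
  then have "3 * a^2 + y^2 + 3 * (b^2 + c^2) = 2 * m" by (simp only: mult_cancel_left) simp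
  then show "(case s of (x, y, z, w) \<Rightarrow> (x div 3, y, z div 3, w div 3)) \<in> odd_reps_3133 m \<and>
      (case case s of (x, y, z, w) \<Rightarrow> (x div 3, y, z div 3, w div 3) of (x, y, z, w) \<Rightarrow> (3 * x, y, 3 * z, 3 * w)) = s"
    using t unfolding s abc by (simp add: odd_reps_1311_def odd_reps_3133_def)
next
  fix s assume "s \<in> odd_reps_3133 m"
  then obtain x y z w where s: "s = (x, y, z, w)" "odd x" "odd y" "odd z" "odd w"
    "3 * x^2 + y^2 + 3 * (z^2 + w^2) = 2 * m" by (auto simp: odd_reps_3133_def)
  have "(3 * x)^2 + 3 * y^2 + ((3 * z)^2 + (3 * w)^2) = 3 * (3 * x^2 + y^2 + 3 * (z^2 + w^2))"
    by (simp add: power2_eq_square)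
  then have "(3 * x)^2 + 3 * y^2 + ((3 * z)^2 + (3 * w)^2) = 2 * (3 * m)" using s(6) by simp
  then show "(case s of (x, y, z, w) \<Rightarrow> (3 * x, y, 3 * z, 3 * w)) \<in> {(x, y, z, w) \<in> odd_reps_1311 (3 * m). 3 dvd x} \<and>
      (case case s of (x, y, z, w) \<Rightarrow> (3 * x, y, 3 * z, 3 * w) of (x, y, z, w) \<Rightarrow> (x div 3, y, z div 3, w div 3)) = s"
    using s(2-5) unfolding s(1) by (simp add: odd_reps_1311_def)
qed

text \<open>When x, z, w are all prime to 3, three residues 1 or -1 add up to 0 modulo 3 exactly if
  they coincide.\<close>

lemma balanced_reps_multiple_of_3: "(x, y, z, w) \<in> balanced_reps (3 * m) \<longleftrightarrow> (x, y, z, w) \<in> odd_reps_1311 (3 * m) \<and> 3 dvd x - z \<and> 3 dvd x - w"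
proof -
  have "3 dvd x + z + w \<longleftrightarrow> 3 dvd x - z \<and> 3 dvd x - w" if t: "(x, y, z, w) \<in> odd_reps_1311 (3 * m)"
    using odd_reps_1311_multiple_of_3[OF t] by presburger
  then show ?thesis by (auto simp: balanced_reps_def)
qed

text \<open>Solutions with x, z, w all divisible by 3 are balanced, and there are
  \<open>card (odd_reps_3133 m)\<close> of them. Among the others the signs of z and w relative to x
  are free, so one quarter is balanced.\<close>

lemma card_odd_reps_1311_multiple_of_3: "card (odd_reps_1311 (3 * m)) + 3 * card (odd_reps_3133 m) = 4 * card (balanced_reps (3 * m))"
proof -
  let ?T = "odd_reps_1311 (3 * m)"
  let ?Z = "{(x, y, z, w) \<in> ?T. 3 dvd x}" and ?U = "{(x, y, z, w) \<in> ?T. \<not> 3 dvd x}"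
  let ?V = "{(x, y, z, w) \<in> ?T. \<not> 3 dvd x \<and> 3 dvd x - z}"
  let ?W = "{(x, y, z, w) \<in> ?T. \<not> 3 dvd x \<and> 3 dvd x - z \<and> 3 dvd x - w}"
  have fin: "finite ?U" "finite ?V" "finite ?Z" "finite ?W" by (rule finite_subset[OF _ finite_odd_reps_1311[of "3 * m"]]; auto)+
  have toggle: "3 dvd x - - z \<longleftrightarrow> \<not> 3 dvd x - z" if "\<not> 3 dvd x" "\<not> 3 dvd z" for x z :: int
    using that by presburger
  have "card ?U = 2 * card {s \<in> ?U. case s of (x, y, z, w) \<Rightarrow> 3 dvd x - z}"
  proof (rule card_involution[OF fin(1), where f = "\<lambda>(x, y, z, w). (x, y, -z, w)"])
    fix s assume "s \<in> ?U"
    then obtain x y z w where s: "s = (x, y, z, w)" "(x, y, z, w) \<in> ?T" "\<not> 3 dvd x" by auto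
    then have "\<not> 3 dvd z" using odd_reps_1311_multiple_of_3 by blast
    from toggle[OF s(3) this] s(2,3)
    show "(case s of (x, y, z, w) \<Rightarrow> (x, y, -z, w)) \<in> ?U \<and>
      (case case s of (x, y, z, w) \<Rightarrow> (x, y, -z, w) of (x, y, z, w) \<Rightarrow> (x, y, -z, w)) = s \<and>
      ((case case s of (x, y, z, w) \<Rightarrow> (x, y, -z, w) of (x, y, z, w) \<Rightarrow> 3 dvd x - z) \<longleftrightarrow> \<not> (case s of (x, y, z, w) \<Rightarrow> 3 dvd x - z))"
      unfolding s(1) by (simp add: odd_reps_1311_def)
  qed
  also have "{s \<in> ?U. case s of (x, y, z, w) \<Rightarrow> 3 dvd x - z} = ?V" by auto
  also have "card ?V = 2 * card {s \<in> ?V. case s of (x, y, z, w) \<Rightarrow> 3 dvd x - w}"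
  proof (rule card_involution[OF fin(2), where f = "\<lambda>(x, y, z, w). (x, y, z, -w)"])
    fix s assume "s \<in> ?V"
    then obtain x y z w where s: "s = (x, y, z, w)" "(x, y, z, w) \<in> ?T" "\<not> 3 dvd x" "3 dvd x - z" by auto
    then have "\<not> 3 dvd w" using odd_reps_1311_multiple_of_3 by blast
    from toggle[OF s(3) this] s(2-4)
    show "(case s of (x, y, z, w) \<Rightarrow> (x, y, z, -w)) \<in> ?V \<and>
      (case case s of (x, y, z, w) \<Rightarrow> (x, y, z, -w) of (x, y, z, w) \<Rightarrow> (x, y, z, -w)) = s \<and>
      ((case case s of (x, y, z, w) \<Rightarrow> (x, y, z, -w) of (x, y, z, w) \<Rightarrow> 3 dvd x - w) \<longleftrightarrow> \<not> (case s of (x, y, z, w) \<Rightarrow> 3 dvd x - w))"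
      unfolding s(1) by (simp add: odd_reps_1311_def)
  qed
  also have "{s \<in> ?V. case s of (x, y, z, w) \<Rightarrow> 3 dvd x - w} = ?W" by auto
  finally have "card ?U = 2 * (2 * card ?W)" .
  then have U: "card ?U = 4 * card ?W" by linarith
  have "?T = ?Z \<union> ?U" by auto
  then have T: "card ?T = card ?Z + card ?U" using card_Un_disjoint[OF fin(3) fin(1)] by fastforce
  have "balanced_reps (3 * m) = ?Z \<union> ?W"
  proof (intro equalityI subsetI)
    fix s assume "s \<in> balanced_reps (3 * m)"
    then show "s \<in> ?Z \<union> ?W" by (cases s) (auto simp: balanced_reps_multiple_of_3)
  next
    fix s assume s: "s \<in> ?Z \<union> ?W"
    obtain x y z w where e: "s = (x, y, z, w)" by (cases s)
    show "s \<in> balanced_reps (3 * m)" using s odd_reps_1311_multiple_of_3[of x y z w m] unfolding e balanced_reps_multiple_of_3 by auto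
  qed
  then have "card (balanced_reps (3 * m)) = card ?Z + card ?W" using card_Un_disjoint[OF fin(3) fin(4)] by fastforce
  then show ?thesis using T U card_odd_reps_3133[of m] by linarith
qed

text \<open>In the coordinates \<open>s = (x + z + w)/3\<close>, \<open>h = y\<close>, \<open>p = (z - w)/6\<close>, \<open>q = (x - z)/6\<close> the form becomes
  symmetric in \<open>s\<close> and \<open>h\<close>, and swapping them or negating \<open>s\<close> toggles \<open>3 | x\<close>.\<close>

lemma card_balanced_reps_eq_twice:
  assumes m: "m mod 3 = 2"
  shows "card (balanced_reps (3 * m)) = 2 * card (odd_reps_3133 m)"
proof -
  define E where "E = {(s, h, p, q). odd s \<and> odd h \<and> s^2 + h^2 + 8 * (p^2 + p * q + q^2) = 2 * m}"
  let ?f = "\<lambda>(x, y, z, w). ((x + z + w) div 3, y, (z - w) div 6, (x - z) div 6)"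
  let ?g = "\<lambda>(s, h, p, q). (s + 2 * p + 4 * q, h, s + 2 * p - 2 * q, s - 4 * p - 2 * q) :: int \<times> int \<times> int \<times> int"
  have 1: "?f r \<in> E \<and> ?g (?f r) = r" if rT: "r \<in> balanced_reps (3 * m)" for r
  proof -
    obtain x y z w where r: "r = (x, y, z, w)" by (cases r)
    have h: "(x, y, z, w) \<in> odd_reps_1311 (3 * m)" "3 dvd x - z" "3 dvd x - w" using rT unfolding r balanced_reps_multiple_of_3 by auto
    then have o: "odd x" "odd y" "odd z" "odd w" and e: "x^2 + 3 * y^2 + (z^2 + w^2) = 2 * (3 * m)" by (auto simp: odd_reps_1311_def)
    have "6 dvd x - z" "6 dvd z - w" using o h by presburger+
    then obtain p q where pq: "x - z = 6 * q" "z - w = 6 * p" by (elim dvdE)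
    define s where "s = z - 2 * p + 2 * q"
    have x: "x = s + 2 * p + 4 * q" "z = s + 2 * p - 2 * q" "w = s - 4 * p - 2 * q" using pq by (simp_all add: s_def)
    have "3 * (s^2 + y^2 + 8 * (p^2 + p * q + q^2)) = x^2 + 3 * y^2 + (z^2 + w^2)"
      unfolding x by (simp add: power2_eq_square algebra_simps)
    then have "3 * (s^2 + y^2 + 8 * (p^2 + p * q + q^2)) = 3 * (2 * m)" using e by simp
    then have "s^2 + y^2 + 8 * (p^2 + p * q + q^2) = 2 * m" by (simp only: mult_cancel_left) simp
    moreover have "odd s" using o(3) by (simp add: s_def)
    moreover have "?f r = (s, y, p, q)" unfolding r x by simp
    ultimately show ?thesis using o(2) r x by (simp add: E_def)
  qed
  have 2: "?g r \<in> balanced_reps (3 * m) \<and> ?f (?g r) = r" if "r \<in> E" for r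
  proof -
    obtain s h p q where r: "r = (s, h, p, q)" "odd s" "odd h" "s^2 + h^2 + 8 * (p^2 + p * q + q^2) = 2 * m"
      using \<open>r \<in> E\<close> by (auto simp: E_def)
    have "(s + 2 * p + 4 * q)^2 + 3 * h^2 + ((s + 2 * p - 2 * q)^2 + (s - 4 * p - 2 * q)^2) = 3 * (s^2 + h^2 + 8 * (p^2 + p * q + q^2))"
      by (simp add: power2_eq_square algebra_simps)
    then have "(s + 2 * p + 4 * q)^2 + 3 * h^2 + ((s + 2 * p - 2 * q)^2 + (s - 4 * p - 2 * q)^2) = 2 * (3 * m)"
      using r(4) by simp
    moreover have "s + 2 * p + 4 * q - (s + 2 * p - 2 * q) = 3 * (2 * q)" "s + 2 * p + 4 * q - (s - 4 * p - 2 * q) = 3 * (2 * p + 2 * q)"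
      by simp_all
    moreover have "?f (?g r) = r" unfolding r(1) by simp
    ultimately show ?thesis using r(2,3) unfolding r(1) by (simp add: balanced_reps_multiple_of_3 odd_reps_1311_def)
  qed
  have c: "card (balanced_reps (3 * m)) = card E" by (rule card_eq_witness[where f = ?f and g = ?g]) (fact 1, fact 2)
  have d: "3 dvd s + 2 * p + 4 * q \<longleftrightarrow> 3 dvd s - p + q" for s p q :: int by presburger
  have z: "{(x, y, z, w) \<in> odd_reps_1311 (3 * m). 3 dvd x} = {r \<in> balanced_reps (3 * m). 3 dvd fst r}"
  proof (intro equalityI subsetI)
    fix r assume "r \<in> {(x, y, z, w) \<in> odd_reps_1311 (3 * m). 3 dvd x}"
    then show "r \<in> {r \<in> balanced_reps (3 * m). 3 dvd fst r}"
      using odd_reps_1311_multiple_of_3[of "fst r"] by (cases r) (auto simp: balanced_reps_multiple_of_3)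
  next
    fix r assume "r \<in> {r \<in> balanced_reps (3 * m). 3 dvd fst r}"
    then show "r \<in> {(x, y, z, w) \<in> odd_reps_1311 (3 * m). 3 dvd x}" by (cases r) (auto simp: balanced_reps_multiple_of_3)
  qed
  have "card {r \<in> balanced_reps (3 * m). 3 dvd fst r} = card {r \<in> E. case r of (s, h, p, q) \<Rightarrow> 3 dvd s - p + q}"
  proof (rule card_eq_witness[where f = ?f and g = ?g])
    fix r assume "r \<in> {r \<in> balanced_reps (3 * m). 3 dvd fst r}"
    then have r: "?f r \<in> E" "?g (?f r) = r" "3 dvd fst r" using 1 by auto
    obtain s h p q where e: "?f r = (s, h, p, q)" by (cases "?f r")
    have "fst r = s + 2 * p + 4 * q" using r(2) unfolding e by auto
    then show "?f r \<in> {r \<in> E. case r of (s, h, p, q) \<Rightarrow> 3 dvd s - p + q} \<and> ?g (?f r) = r"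
      using r d unfolding e by simp
  next
    fix r assume r: "r \<in> {r \<in> E. case r of (s, h, p, q) \<Rightarrow> 3 dvd s - p + q}"
    obtain s h p q where e: "r = (s, h, p, q)" by (cases r)
    have "3 dvd fst (?g r)" using r d unfolding e by simp
    then show "?g r \<in> {r \<in> balanced_reps (3 * m). 3 dvd fst r} \<and> ?f (?g r) = r" using r 2[of r] by blast
  qed
  then have odd_reps_3133: "card (odd_reps_3133 m) = card {r \<in> E. case r of (s, h, p, q) \<Rightarrow> 3 dvd s - p + q}"
    using card_odd_reps_3133[of m] unfolding z by simp
  have fin: "finite E"
  proof -
    have "r \<in> ?f ` balanced_reps (3 * m)" if "r \<in> E" for r
    proof -
      have "?f (?g r) \<in> ?f ` balanced_reps (3 * m)" by (rule imageI[OF conjunct1[OF 2[OF that]]])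
      then show ?thesis by (simp only: conjunct2[OF 2[OF that]])
    qed
    then have "E \<subseteq> ?f ` balanced_reps (3 * m)" by (rule subsetI)
    moreover have "finite (balanced_reps (3 * m))" unfolding balanced_reps_def using finite_odd_reps_1311 by simp
    ultimately show ?thesis using finite_surj by blast
  qed
  have "card E = 2 * card {r \<in> E. case r of (s, h, p, q) \<Rightarrow> 3 dvd s - p + q}"
  proof (rule card_involution[OF fin, where f = "\<lambda>(s, h, p, q). if 3 dvd s \<or> 3 dvd h then (h, s, p, q) else (-s, h, p, q)"])
    fix r assume "r \<in> E"
    then obtain s h p q where r: "r = (s, h, p, q)" "odd s" "odd h" and e: "s^2 + h^2 + 8 * (p^2 + p * q + q^2) = 2 * m"
      by (auto simp: E_def)
    \<comment> \<open>8 (p^2 + pq + q^2) is -(p - q)^2 modulo 3, so three squares control the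
      residues.\<close>
    have "s^2 + h^2 - (p - q)^2 = 2 * m - 3 * (3 * p^2 + 2 * (p * q) + 3 * q^2)"
      using e by (simp add: power2_eq_square algebra_simps)
    then have "(s^2 + h^2 - (p - q)^2) mod 3 = 1" using m by presburger
    moreover have "(s^2 + h^2 - (p - q)^2) mod 3 = (s^2 mod 3 + h^2 mod 3 - (p - q)^2 mod 3) mod 3"
      by (intro mod_diff_cong mod_add_cong) simp_all
    ultimately have "((if 3 dvd s then 0 else 1) + (if 3 dvd h then 0 else 1) - (if 3 dvd p - q then 0 else 1 :: int)) mod 3 = 1"
      by (simp only: square_mod_3)
    then have k: "3 dvd h \<and> \<not> 3 dvd s \<and> 3 dvd p - q \<or> 3 dvd s \<and> \<not> 3 dvd h \<and> 3 dvd p - q \<or> \<not> 3 dvd s \<and> \<not> 3 dvd h \<and> \<not> 3 dvd p - q"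
      by (simp split: if_splits)
    \<comment> \<open>If p = q modulo 3, exactly one of s, h is a multiple of 3 and swapping
      exchanges the roles; otherwise s and p - q are both units modulo 3 and negating s changes
      whether they agree.\<close>
    have "(if 3 dvd s \<or> 3 dvd h then 3 dvd h - p + q else 3 dvd (- s) - p + q) \<longleftrightarrow> \<not> 3 dvd s - p + q"
      using k by presburger
    then show "(case r of (s, h, p, q) \<Rightarrow> if 3 dvd s \<or> 3 dvd h then (h, s, p, q) else (-s, h, p, q)) \<in> E \<and>
      (case case r of (s, h, p, q) \<Rightarrow> if 3 dvd s \<or> 3 dvd h then (h, s, p, q) else (-s, h, p, q) of
        (s, h, p, q) \<Rightarrow> if 3 dvd s \<or> 3 dvd h then (h, s, p, q) else (-s, h, p, q)) = r \<and>
      ((case case r of (s, h, p, q) \<Rightarrow> if 3 dvd s \<or> 3 dvd h then (h, s, p, q) else (-s, h, p, q) of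
        (s, h, p, q) \<Rightarrow> 3 dvd s - p + q) \<longleftrightarrow> \<not> (case r of (s, h, p, q) \<Rightarrow> 3 dvd s - p + q))"
      using r e by (cases "3 dvd s \<or> 3 dvd h") (auto simp: E_def add.commute)
  qed
  then show ?thesis using c odd_reps_3133 by simp
qed

lemma odd_reps_3133_empty:
  assumes m: "m mod 3 = 1"
  shows "odd_reps_3133 m = {}"
proof -
  have False if s: "s \<in> odd_reps_3133 m" for s
  proof -
    obtain x y z w where e: "3 * x^2 + y^2 + 3 * (z^2 + w^2) = 2 * m" using s by (auto simp: odd_reps_3133_def)
    then have "y^2 mod 3 = 2" using m by presburger
    then show False using square_mod_3[of y] by (simp split: if_splits)
  qed
  then show ?thesis by blast
qed

lemma card_odd_reps_3133_multiple_of_3: "card (odd_reps_3133 (3 * k)) = card (odd_reps_1311 k)"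
proof (rule card_eq_witness[where f = "\<lambda>(x, y, z, w). (x, y div 3, z, w)" and g = "\<lambda>(x, y, z, w). (x, 3 * y, z, w)"])
  fix s assume "s \<in> odd_reps_3133 (3 * k)"
  then obtain x y z w where s: "s = (x, y, z, w)" "odd x" "odd y" "odd z" "odd w"
    and e: "3 * x^2 + y^2 + 3 * (z^2 + w^2) = 2 * (3 * k)" by (auto simp: odd_reps_3133_def)
  have "y^2 mod 3 = 0" using e by presburger
  then have "3 dvd y" using square_mod_3[of y] by (simp split: if_splits)
  then obtain a where a: "y = 3 * a" by blast
  have "3 * (x^2 + 3 * a^2 + (z^2 + w^2)) = 3 * (2 * k)" using e unfolding a by (simp add: power2_eq_square)
  then have "x^2 + 3 * a^2 + (z^2 + w^2) = 2 * k" by (simp only: mult_cancel_left) simp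
  then show "(case s of (x, y, z, w) \<Rightarrow> (x, y div 3, z, w)) \<in> odd_reps_1311 k \<and>
      (case case s of (x, y, z, w) \<Rightarrow> (x, y div 3, z, w) of (x, y, z, w) \<Rightarrow> (x, 3 * y, z, w)) = s"
    using s a by (simp add: odd_reps_1311_def)
next
  fix s assume "s \<in> odd_reps_1311 k"
  then obtain x y z w where s: "s = (x, y, z, w)" "odd x" "odd y" "odd z" "odd w"
    and e: "x^2 + 3 * y^2 + (z^2 + w^2) = 2 * k" by (auto simp: odd_reps_1311_def)
  have "3 * x^2 + (3 * y)^2 + 3 * (z^2 + w^2) = 3 * (x^2 + 3 * y^2 + (z^2 + w^2))" by (simp add: power2_eq_square)
  then have "3 * x^2 + (3 * y)^2 + 3 * (z^2 + w^2) = 2 * (3 * k)" using e by simp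
  then show "(case s of (x, y, z, w) \<Rightarrow> (x, 3 * y, z, w)) \<in> odd_reps_3133 (3 * k) \<and>
      (case case s of (x, y, z, w) \<Rightarrow> (x, 3 * y, z, w) of (x, y, z, w) \<Rightarrow> (x, y div 3, z, w)) = s"
    using s by (simp add: odd_reps_3133_def)
qed

section \<open>Divisor sums and the Kronecker symbol\<close>

definition chi12_sum :: "int \<Rightarrow> int" where
  "chi12_sum n = divisor_sum (\<lambda>d. chi12 d * d) n"

lemma chi12_square:
  assumes "odd d" "\<not> 3 dvd d"
  shows "chi12 d * chi12 d = 1"
proof -
  have "d mod 4 = 1 \<or> d mod 4 = 3" "d mod 3 = 1 \<or> d mod 3 = 2" using assms by presburger+
  then show ?thesis by (auto simp: chi12_def chi3_def chi4_def)
qed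

text \<open>\<open>chi12 d = chi12 n * chi12 (n div d)\<close>, because \<open>chi12\<close> has
  values 1 and -1 on the divisors of n; then d and \<open>n div d\<close> are exchanged.\<close>

lemma chi12_cosum_coprime:
  assumes "n > 0" "odd n" "\<not> 3 dvd n"
  shows "chi12_cosum n = chi12 n * chi12_sum n"
proof -
  have "chi12_cosum n = (\<Sum>d | 0 < d \<and> d dvd n. chi12 n * (chi12 (n div d) * (n div d)))"
    unfolding chi12_cosum_def
  proof (rule sum.cong[OF refl])
    fix d assume "d \<in> {d. 0 < d \<and> d dvd n}"
    then obtain k where k: "n = d * k" "0 < d" by blast
    then have "odd k" "\<not> 3 dvd k" using assms by auto
    then have "chi12 (d * k) * chi12 k = chi12 d" using chi12_square[of k] by (simp add: chi12_mult)
    then show "chi12 d * (n div d) = chi12 n * (chi12 (n div d) * (n div d))" using k by simp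
  qed
  also have "\<dots> = chi12 n * chi12_sum n"
    unfolding chi12_sum_def by (subst divisor_sum_swap[OF assms(1)]) (simp add: sum_distrib_left)
  finally show ?thesis .
qed

text \<open>The divisors of 3n that do not divide n are multiples of 3, where \<open>chi12\<close>
  vanishes; for the others the cofactor triples.\<close>

lemma chi12_cosum_3:
  assumes "n > 0"
  shows "chi12_cosum (3 * n) = 3 * chi12_cosum n"
proof -
  have "chi12_cosum (3 * n) = (\<Sum>d | 0 < d \<and> d dvd n. chi12 d * (3 * n div d))"
    unfolding chi12_cosum_def
  proof (rule sum.mono_neutral_right)
    show "\<forall>d\<in>{d. 0 < d \<and> d dvd 3 * n} - {d. 0 < d \<and> d dvd n}. chi12 d * (3 * n div d) = 0"
    proof
      fix d assume d: "d \<in> {d. 0 < d \<and> d dvd 3 * n} - {d. 0 < d \<and> d dvd n}"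
      have "3 dvd d"
      proof (rule ccontr)
        assume "\<not> 3 dvd d"
        then have "coprime d 3" using prime_imp_coprime[of "3::int" d] by (simp add: coprime_commute)
        then show False using d by (auto simp: coprime_dvd_mult_right_iff)
      qed
      then show "chi12 d * (3 * n div d) = 0" by (simp add: chi12_def chi3_def)
    qed
  qed (use assms in auto)
  also have "\<dots> = 3 * chi12_cosum n"
    unfolding chi12_cosum_def sum_distrib_left by (rule sum.cong) (auto simp: div_mult_swap)
  finally show ?thesis .
qed

lemma chi12_cosum_power_3:
  assumes "n > 0" "odd n" "\<not> 3 dvd n"
  shows "chi12_cosum (3 ^ v * n) = 3 ^ v * chi12 n * chi12_sum n"
proof (induction v)
  case 0
  then show ?case using chi12_cosum_coprime[OF assms] by simp
next
  case (Suc v)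
  have "chi12_cosum (3 ^ Suc v * n) = 3 * chi12_cosum (3 ^ v * n)" using chi12_cosum_3[of "3 ^ v * n"] assms by (simp add: mult.assoc)
  then show ?case using Suc by simp
qed

section \<open>Evaluation of the counts and the recursion by 9\<close>

lemma card_odd_reps_1311_1_mod_3:
  assumes "n > 0" "n mod 4 = 3" "n mod 3 = 1"
  shows "int (card (odd_reps_1311 n)) = 8 * chi12_cosum n"
  using card_odd_minus_balanced_reps[OF assms(1,2)] card_odd_reps_1311_eq_twice_balanced[OF assms(3)] by simp

lemma card_odd_reps_1311_2_mod_3:
  assumes "n > 0" "n mod 4 = 3" "n mod 3 = 2"
  shows "int (card (odd_reps_1311 n)) = 4 * chi12_cosum n"
  using card_odd_minus_balanced_reps[OF assms(1,2)] balanced_reps_empty[OF assms(3)] by simp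

text \<open>Two linear equations for the total count T and the balanced count B at 3m: T - B = 12 C
  with C = \<open>chi12_cosum m\<close>, and T + 3 T3 = 4 B.\<close>

lemma card_reps_recursion:
  assumes "m > 0" "m mod 4 = 1"
  shows "int (card (balanced_reps (3 * m))) = int (card (odd_reps_3133 m)) + 4 * chi12_cosum m"
    and "int (card (odd_reps_1311 (3 * m))) = int (card (odd_reps_3133 m)) + 16 * chi12_cosum m"
proof -
  have "(3 * m) mod 4 = 3" using assms(2) by presburger
  then have "int (card (odd_reps_1311 (3 * m))) - int (card (balanced_reps (3 * m))) = 12 * chi12_cosum m"
    using card_odd_minus_balanced_reps[of "3 * m"] chi12_cosum_3[OF assms(1)] assms(1) by simp
  then show "int (card (balanced_reps (3 * m))) = int (card (odd_reps_3133 m)) + 4 * chi12_cosum m"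
    "int (card (odd_reps_1311 (3 * m))) = int (card (odd_reps_3133 m)) + 16 * chi12_cosum m"
    using card_odd_reps_1311_multiple_of_3[of m] by linarith+
qed

lemma chi12_cases:
  assumes "odd n"
  shows "n mod 4 = 1 \<Longrightarrow> n mod 3 = 1 \<Longrightarrow> chi12 n = 1" "n mod 4 = 1 \<Longrightarrow> n mod 3 = 2 \<Longrightarrow> chi12 n = -1"
    "n mod 4 = 3 \<Longrightarrow> n mod 3 = 1 \<Longrightarrow> chi12 n = -1" "n mod 4 = 3 \<Longrightarrow> n mod 3 = 2 \<Longrightarrow> chi12 n = 1"
  by (simp_all add: chi12_def chi3_def chi4_def)

text \<open>Induction in steps of two. For v = 0 the count is zero when n1 is 1 modulo 3; otherwise
  the balanced count is both twice it and \<open>4 * chi12_cosum n1\<close> more than it. For v = 1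
  it is the count for x^2 + 3y^2 + z^2 + w^2 at n1.\<close>

lemma card_odd_reps_3133_formula:
  assumes "n1 > 0" "\<not> 3 dvd n1" "(3 ^ v * n1) mod 4 = 1"
  shows "int (card (odd_reps_3133 (3 ^ v * n1))) = 2 * (3 ^ v * chi12 n1 - 1) * chi12_sum n1"
  using assms(3)
proof (induction v rule: less_induct)
  case (less v)
  have "odd M" if "M mod 4 = 1" for M :: int using that by presburger
  then have "odd (3 ^ v * n1)" using less.prems by blast
  then have odd: "odd n1" by simp
  have B: "chi12_cosum (3 ^ k * n1) = 3 ^ k * chi12 n1 * chi12_sum n1" for k by (rule chi12_cosum_power_3[OF assms(1) odd assms(2)])
  have r3: "n1 mod 3 = 1 \<or> n1 mod 3 = 2" using assms(2) by presburger
  consider "v = 0" | "v = 1" | k where "v = Suc (Suc k)" by (metis One_nat_def not0_implies_Suc)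
  then show ?case
  proof cases
    case 1
    then have m4: "n1 mod 4 = 1" using less.prems by simp
    from r3 show ?thesis
    proof
      assume "n1 mod 3 = 1"
      then show ?thesis using odd_reps_3133_empty[of n1] chi12_cases(1)[OF odd m4] 1 by simp
    next
      assume r: "n1 mod 3 = 2"
      have "int (card (odd_reps_3133 n1)) = 4 * chi12_cosum n1"
        using card_balanced_reps_eq_twice[OF r] card_reps_recursion(1)[OF assms(1) m4] by simp
      then show ?thesis using B[of 0] chi12_cases(2)[OF odd m4 r] 1 by simp
    qed
  next
    case 2
    then have "(3 * n1) mod 4 = 1" using less.prems by simp
    then have m4: "n1 mod 4 = 3" by presburger
    from r3 show ?thesis
    proof
      assume r: "n1 mod 3 = 1"
      then show ?thesis using card_odd_reps_3133_multiple_of_3[of n1] card_odd_reps_1311_1_mod_3[OF assms(1) m4 r] B[of 0] chi12_cases(3)[OF odd m4 r] 2 by simp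
    next
      assume r: "n1 mod 3 = 2"
      then show ?thesis using card_odd_reps_3133_multiple_of_3[of n1] card_odd_reps_1311_2_mod_3[OF assms(1) m4 r] B[of 0] chi12_cases(4)[OF odd m4 r] 2 by simp
    qed
  next
    case 3
    let ?m = "3 ^ k * n1"
    have m: "3 ^ v * n1 = 3 * (3 * ?m)" using 3 by simp
    have "M mod 4 = 1" if "(3 * (3 * M)) mod 4 = 1" for M :: int using that by presburger
    then have m4: "?m mod 4 = 1" using less.prems unfolding m .
    have "int (card (odd_reps_3133 (3 ^ v * n1))) = int (card (odd_reps_1311 (3 * ?m)))" unfolding m card_odd_reps_3133_multiple_of_3 ..
    also have "\<dots> = int (card (odd_reps_3133 ?m)) + 16 * chi12_cosum ?m" by (rule card_reps_recursion(2)) (use assms m4 in auto)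
    also have "\<dots> = 2 * (3 ^ k * chi12 n1 - 1) * chi12_sum n1 + 16 * (3 ^ k * chi12 n1 * chi12_sum n1)"
      unfolding B using less.IH[of k] m4 3 by simp
    \<comment> \<open>2 * 3^k + 16 * 3^k = 2 * 3^(k + 2).\<close>
    also have "\<dots> = 2 * (3 ^ v * chi12 n1 - 1) * chi12_sum n1" using 3 by (simp add: algebra_simps)
    finally show ?thesis .
  qed
qed

section \<open>The form x^2 + 3y^2 + 9z^2 + 9w^2\<close>

definition odd_reps_1399 :: "int \<Rightarrow> (int \<times> int \<times> int \<times> int) set" where
  "odd_reps_1399 n = {(x, y, z, w). (odd x \<and> odd y) \<and> (odd z \<and> odd w) \<and> x^2 + 3 * y^2 + 9 * (z^2 + w^2) = 2 * n}"

text \<open>Multiplying by 8 and completing squares adds 1 + 3 + 9 + 9 = 22 = 2 * 11.\<close>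

lemma t_eq_card_odd_reps_1399: "Defs.t 1 3 9 9 n = card (odd_reps_1399 (4 * int n + 11))"
  unfolding Defs.t_def
proof (rule card_eq_witness[where f = "\<lambda>(x, y, z, w). (2 * x - 1, 2 * y - 1, 2 * z - 1, 2 * w - 1)"
      and g = "\<lambda>(x, y, z, w). ((x + 1) div 2, (y + 1) div 2, (z + 1) div 2, (w + 1) div 2)"])
  have sq: "(2 * x - 1)^2 = 8 * (x * (x - 1) div 2) + 1" for x :: int
  proof -
    have "even (x * (x - 1))" by simp
    then have "2 * (x * (x - 1) div 2) = x * (x - 1)" by (rule dvd_mult_div_cancel)
    then have "8 * (x * (x - 1) div 2) = 4 * (x * (x - 1))" by linarith
    then show ?thesis by (simp add: power2_eq_square algebra_simps)
  qed
  {
    fix s :: "int \<times> int \<times> int \<times> int"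
    assume "s \<in> {(x, y, z, w). int n = int 1 * (x * (x - 1) div 2) + int 3 * (y * (y - 1) div 2)
           + int 9 * (z * (z - 1) div 2) + int 9 * (w * (w - 1) div 2)}"
    then obtain x y z w where s: "s = (x, y, z, w)" and
      e: "int n = x * (x - 1) div 2 + 3 * (y * (y - 1) div 2) + 9 * (z * (z - 1) div 2) + 9 * (w * (w - 1) div 2)" by auto
    have "(2 * x - 1)^2 + 3 * (2 * y - 1)^2 + 9 * ((2 * z - 1)^2 + (2 * w - 1)^2) = 2 * (4 * int n + 11)"
      unfolding sq e by simp
    then show "(case s of (x, y, z, w) \<Rightarrow> (2 * x - 1, 2 * y - 1, 2 * z - 1, 2 * w - 1)) \<in> odd_reps_1399 (4 * int n + 11) \<and>
        (case case s of (x, y, z, w) \<Rightarrow> (2 * x - 1, 2 * y - 1, 2 * z - 1, 2 * w - 1) of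
          (x, y, z, w) \<Rightarrow> ((x + 1) div 2, (y + 1) div 2, (z + 1) div 2, (w + 1) div 2)) = s"
      unfolding s odd_reps_1399_def by simp
  next
    fix s assume "s \<in> odd_reps_1399 (4 * int n + 11)"
    then obtain x y z w where s: "s = (x, y, z, w)" "odd x" "odd y" "odd z" "odd w"
      and e: "x^2 + 3 * y^2 + 9 * (z^2 + w^2) = 2 * (4 * int n + 11)" by (auto simp: odd_reps_1399_def)
    have half: "\<exists>a. x = 2 * a - 1" if "odd x" for x :: int using that by presburger
    obtain a b c d where abcd: "x = 2 * a - 1" "y = 2 * b - 1" "z = 2 * c - 1" "w = 2 * d - 1"
      using half s(2-5) by meson
    have "int n = a * (a - 1) div 2 + 3 * (b * (b - 1) div 2) + 9 * (c * (c - 1) div 2) + 9 * (d * (d - 1) div 2)"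
      using e unfolding abcd sq by simp
    then show "(case s of (x, y, z, w) \<Rightarrow> ((x + 1) div 2, (y + 1) div 2, (z + 1) div 2, (w + 1) div 2)) \<in>
        {(x, y, z, w). int n = int 1 * (x * (x - 1) div 2) + int 3 * (y * (y - 1) div 2)
           + int 9 * (z * (z - 1) div 2) + int 9 * (w * (w - 1) div 2)} \<and>
        (case case s of (x, y, z, w) \<Rightarrow> ((x + 1) div 2, (y + 1) div 2, (z + 1) div 2, (w + 1) div 2) of
          (x, y, z, w) \<Rightarrow> (2 * x - 1, 2 * y - 1, 2 * z - 1, 2 * w - 1)) = s"
      unfolding s(1) abcd by simp
  }
qed

lemma odd_reps_1399_empty:
  assumes "n mod 3 = 1"
  shows "odd_reps_1399 n = {}"
proof -
  have False if s: "s \<in> odd_reps_1399 n" for s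
  proof -
    obtain x y z w where e: "x^2 + 3 * y^2 + 9 * (z^2 + w^2) = 2 * n" using s by (auto simp: odd_reps_1399_def)
    then have "x^2 mod 3 = 2" using assms by presburger
    then show False using square_mod_3[of x] by (simp split: if_splits)
  qed
  then show ?thesis by blast
qed

lemma card_odd_reps_1399_multiple_of_3: "card (odd_reps_1399 (3 * m)) = card (odd_reps_3133 m)"
proof (rule card_eq_witness[where f = "\<lambda>(x, y, z, w). (x div 3, y, z, w)" and g = "\<lambda>(x, y, z, w). (3 * x, y, z, w)"])
  fix s assume "s \<in> odd_reps_1399 (3 * m)"
  then obtain x y z w where s: "s = (x, y, z, w)" "odd x" "odd y" "odd z" "odd w"
    and e: "x^2 + 3 * y^2 + 9 * (z^2 + w^2) = 2 * (3 * m)" by (auto simp: odd_reps_1399_def)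
  have "x^2 mod 3 = 0" using e by presburger
  then have "3 dvd x" using square_mod_3[of x] by (simp split: if_splits)
  then obtain a where a: "x = 3 * a" by blast
  have "3 * (3 * a^2 + y^2 + 3 * (z^2 + w^2)) = 3 * (2 * m)" using e unfolding a by (simp add: power2_eq_square)
  then have "3 * a^2 + y^2 + 3 * (z^2 + w^2) = 2 * m" by (simp only: mult_cancel_left) simp
  then show "(case s of (x, y, z, w) \<Rightarrow> (x div 3, y, z, w)) \<in> odd_reps_3133 m \<and>
      (case case s of (x, y, z, w) \<Rightarrow> (x div 3, y, z, w) of (x, y, z, w) \<Rightarrow> (3 * x, y, z, w)) = s"
    using s a by (simp add: odd_reps_3133_def)
next
  fix s assume "s \<in> odd_reps_3133 m"
  then obtain x y z w where s: "s = (x, y, z, w)" "odd x" "odd y" "odd z" "odd w"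
    and e: "3 * x^2 + y^2 + 3 * (z^2 + w^2) = 2 * m" by (auto simp: odd_reps_3133_def)
  have "(3 * x)^2 + 3 * y^2 + 9 * (z^2 + w^2) = 3 * (3 * x^2 + y^2 + 3 * (z^2 + w^2))" by (simp add: power2_eq_square)
  then have "(3 * x)^2 + 3 * y^2 + 9 * (z^2 + w^2) = 2 * (3 * m)" using e by simp
  then show "(case s of (x, y, z, w) \<Rightarrow> (3 * x, y, z, w)) \<in> odd_reps_1399 (3 * m) \<and>
      (case case s of (x, y, z, w) \<Rightarrow> (3 * x, y, z, w) of (x, y, z, w) \<Rightarrow> (x div 3, y, z, w)) = s"
    using s by (simp add: odd_reps_1399_def)
qed

text \<open>Exactly two of x, z, w are multiples of 3. The form is symmetric in these variables, so
  the three possible pairs are equally frequent, and the pair z, w gives the coefficients 9.\<close>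

lemma card_odd_reps_1399_2_mod_3:
  assumes n: "n mod 3 = 2"
  shows "card (odd_reps_1311 n) = 3 * card (odd_reps_1399 n)"
proof -
  let ?X = "{(x, y, z, w) \<in> odd_reps_1311 n. 3 dvd z \<and> 3 dvd w}"
  let ?Z = "{(x, y, z, w) \<in> odd_reps_1311 n. 3 dvd x \<and> 3 dvd w}"
  let ?W = "{(x, y, z, w) \<in> odd_reps_1311 n. 3 dvd x \<and> 3 dvd z}"
  have c: "\<not> 3 dvd x \<and> 3 dvd z \<and> 3 dvd w \<or> 3 dvd x \<and> \<not> 3 dvd z \<and> 3 dvd w \<or> 3 dvd x \<and> 3 dvd z \<and> \<not> 3 dvd w"
    if "(x, y, z, w) \<in> odd_reps_1311 n" for x y z w
  proof -
    have e: "x^2 + 3 * y^2 + (z^2 + w^2) = 2 * n" using that by (simp add: odd_reps_1311_def)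
    have "(2 * n) mod 3 = 1" using n by presburger
    with three_squares_mod_3[OF e] show ?thesis by (simp split: if_splits)
  qed
  have fin: "finite ?X" "finite ?Z" "finite ?W" by (rule finite_subset[OF _ finite_odd_reps_1311[of n]]; auto)+
  have "odd_reps_1311 n = ?X \<union> (?Z \<union> ?W)"
  proof (intro equalityI subsetI)
    fix s assume "s \<in> odd_reps_1311 n"
    then show "s \<in> ?X \<union> (?Z \<union> ?W)" using c by (cases s) auto
  qed auto
  moreover have "?X \<inter> (?Z \<union> ?W) = {}" "?Z \<inter> ?W = {}" using c by fastforce+
  note card_Un_disjoint[OF fin(1) finite_UnI[OF fin(2,3)] this(1)] card_Un_disjoint[OF fin(2,3) this(2)]
  ultimately have u: "card (odd_reps_1311 n) = card ?X + (card ?Z + card ?W)" by (simp only:)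
  have 1: "card ?X = card ?Z"
    by (rule card_eq_witness[where f = "\<lambda>(x, y, z, w). (z, y, x, w)" and g = "\<lambda>(x, y, z, w). (z, y, x, w)"])
       (auto simp: odd_reps_1311_def)
  have 2: "card ?X = card ?W"
    by (rule card_eq_witness[where f = "\<lambda>(x, y, z, w). (w, y, z, x)" and g = "\<lambda>(x, y, z, w). (w, y, z, x)"])
       (auto simp: odd_reps_1311_def)
  have 3: "card (odd_reps_1399 n) = card ?X"
  proof (rule card_eq_witness[where f = "\<lambda>(x, y, z, w). (x, y, 3 * z, 3 * w)" and g = "\<lambda>(x, y, z, w). (x, y, z div 3, w div 3)"])
    fix s assume "s \<in> odd_reps_1399 n"
    then show "(case s of (x, y, z, w) \<Rightarrow> (x, y, 3 * z, 3 * w)) \<in> ?X \<and>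
      (case case s of (x, y, z, w) \<Rightarrow> (x, y, 3 * z, 3 * w) of (x, y, z, w) \<Rightarrow> (x, y, z div 3, w div 3)) = s"
      by (cases s) (simp add: odd_reps_1311_def odd_reps_1399_def power_mult_distrib)
  next
    fix s assume "s \<in> ?X"
    then obtain x y z w where s: "s = (x, y, z, w)" "(x, y, z, w) \<in> odd_reps_1311 n" "3 dvd z" "3 dvd w" by auto
    then obtain a b where ab: "z = 3 * a" "w = 3 * b" by (elim dvdE)
    show "(case s of (x, y, z, w) \<Rightarrow> (x, y, z div 3, w div 3)) \<in> odd_reps_1399 n \<and>
      (case case s of (x, y, z, w) \<Rightarrow> (x, y, z div 3, w div 3) of (x, y, z, w) \<Rightarrow> (x, y, 3 * z, 3 * w)) = s"
      using s(2) unfolding s(1) ab by (simp add: odd_reps_1311_def odd_reps_1399_def power_mult_distrib)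
  qed
  show ?thesis using u 1 2 3 by simp
qed

section \<open>The symbol (3/d) as a character modulo 12\<close>

lemma Legendre_3:
  assumes p: "prime p" "p \<noteq> 2"
  shows "Legendre 3 p = chi12 p"
proof (cases "p = 3")
  case True
  then show ?thesis by (simp add: Legendre_def chi12_def chi3_def cong_def)
next
  case False
  have p1: "p > 1" using p prime_gt_1_int by blast
  then have p3: "p > 3" using p False by (cases "p = 2") auto
  have odd: "odd p"
  proof
    assume "even p"
    then have "p = 2" using p primes_dvd_imp_eq[of 2 p] by simp
    then show False using p by simp
  qed
  have n3: "\<not> 3 dvd p" using p False primes_dvd_imp_eq[of 3 p] by auto
  have "Legendre p 3 = chi3 p"
  proof (cases "p mod 3 = 1")
    case True
    then have "[1^2 = p] (mod 3)" by (simp add: cong_def)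
    then have "QuadRes 3 p" unfolding QuadRes_def by blast
    then show ?thesis using True by (simp add: Legendre_def chi3_def cong_def)
  next
    case c: False
    then have r: "p mod 3 = 2" using n3 by presburger
    have "\<not> QuadRes 3 p"
    proof
      assume "QuadRes 3 p"
      then obtain y where "y^2 mod 3 = p mod 3" by (auto simp: QuadRes_def cong_def)
      then show False using r square_mod_3[of y] by (simp split: if_splits)
    qed
    then show ?thesis using r by (simp add: Legendre_def chi3_def cong_def)
  qed
  moreover have "Legendre 3 p * Legendre p 3 = (-1) ^ nat ((3 - 1) div 2 * ((p - 1) div 2))"
    by (rule Quadratic_Reciprocity_int) (use p p3 p1 False in auto)
  \<comment> \<open>The reciprocity exponent is (p - 1)/2, whose parity is decided by p modulo
    4.\<close>
  moreover have "(-1) ^ nat ((3 - 1) div 2 * ((p - 1) div 2)) = chi4 p"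
  proof -
    have "p mod 4 = 1 \<or> p mod 4 = 3" using odd by presburger
    then show ?thesis
    proof
      assume "p mod 4 = 1"
      moreover from this obtain k where "p = 4 * k + 1" by (metis mult_div_mod_eq)
      ultimately show ?thesis using p1 by (simp add: chi4_def nat_mult_distrib power_mult)
    next
      assume r: "p mod 4 = 3"
      then have e: "(p - 1) div 2 = 2 * (p div 4) + 1" by presburger
      have "nat (2 * (p div 4) + 1) = 2 * nat (p div 4) + 1" using p1 by (simp add: nat_add_distrib nat_mult_distrib)
      then show ?thesis using r unfolding e by (simp add: chi4_def)
    qed
  qed
  ultimately have "Legendre 3 p * chi3 p = chi4 p" by simp
  moreover have "chi3 p * chi3 p = 1"
  proof -
    have "p mod 3 = 1 \<or> p mod 3 = 2" using n3 by presburger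
    then show ?thesis by (auto simp: chi3_def)
  qed
  ultimately show ?thesis unfolding chi12_def by (metis mult.assoc mult.commute mult.right_neutral)
qed

text \<open>Both sides are completely multiplicative and agree at odd primes. Oddness matters: at 2
  the symbol is -1 while \<open>chi12\<close> is 0.\<close>

lemma kronecker_3:
  assumes "m > 0" "odd m"
  shows "kronecker 3 m = chi12 m"
proof -
  have mset: "chi12 (\<Prod>\<^sub># M) = (\<Prod>p\<in>#M. chi12 p)" for M
    by (induction M) (simp_all add: chi12_mult chi12_def[of 1] chi3_def chi4_def)
  have "kronecker 3 m = (\<Prod>p\<in>#prime_factorization m. kronecker_prime 3 p)"
    using assms by (simp add: kronecker_def)
  also have "\<dots> = (\<Prod>p\<in>#prime_factorization m. chi12 p)"
  proof (rule arg_cong[where f = prod_mset], rule image_mset_cong)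
    fix p assume "p \<in># prime_factorization m"
    then have p: "prime p" "p dvd m" by (auto simp: in_prime_factors_iff)
    then have "p \<noteq> 2" using assms by auto
    then show "kronecker_prime 3 p = chi12 p" using Legendre_3[OF p(1)] by (simp add: kronecker_prime_def)
  qed
  also have "\<dots> = chi12 (\<Prod>\<^sub># (prime_factorization m))" by (rule mset[symmetric])
  also have "\<Prod>\<^sub># (prime_factorization m) = m" using assms by (simp add: prod_mset_prime_factorization)
  finally show ?thesis .
qed

lemma kronecker_divisor_sum:
  fixes k :: nat
  assumes "odd k"
  shows "(\<Sum>d | d dvd k. real d * real_of_int (kronecker 3 (int d))) = real_of_int (chi12_sum (int k))"
proof -
  have k: "k > 0" using assms by (rule odd_pos)
  have "chi12_sum (int k) = (\<Sum>d | d dvd k. kronecker 3 (int d) * int d)"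
    unfolding chi12_sum_def divisor_sum_def
  proof (rule sum.reindex_bij_witness[where i = int and j = nat])
    fix d assume d: "d \<in> {d. 0 < d \<and> d dvd int k}"
    then show "int (nat d) = d" "nat d \<in> {d. d dvd k}" by (auto simp: nat_dvd_iff)
    have "odd d" using d assms by (metis dvd_trans even_of_nat mem_Collect_eq)
    then show "kronecker 3 (int (nat d)) * int (nat d) = chi12 d * d" using d kronecker_3[of d] by simp
  qed (use k in \<open>auto intro: dvd_pos_nat\<close>)
  then show ?thesis by (simp add: mult.commute)
qed

section \<open>The three residue classes of n modulo 3\<close>

theorem theorem2p2:
  fixes n :: nat
  assumes "n \<ge> 1"
  shows "(3 dvd int n - 2 \<longrightarrow> t 1 3 9 9 n = 0) \<and>
         (3 dvd int n \<longrightarrow>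
            real (t 1 3 9 9 n) =
              4 / 3 * (\<Sum>d | d dvd 4 * n + 11. real d * real_of_int (kronecker 3 (int d)))) \<and>
         (\<forall>\<beta> n1 :: nat.
            3 dvd int n - 1 \<and> 4 * n + 11 = 3 ^ \<beta> * n1 \<and> \<not> 3 dvd n1 \<longrightarrow>
            real (t 1 3 9 9 n) =
              2 * (3 powi (int \<beta> - 1) * real_of_int (kronecker 3 (int n1)) - 1) *
              (\<Sum>d | d dvd n1. real d * real_of_int (kronecker 3 (int d))))"
proof (intro conjI impI allI)
  assume "3 dvd int n - 2"
  then have "(4 * int n + 11) mod 3 = 1" by presburger
  then show "t 1 3 9 9 n = 0" unfolding t_eq_card_odd_reps_1399 by (simp add: odd_reps_1399_empty)
next
  assume "3 dvd int n"
  let ?N = "4 * int n + 11"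
  have r: "?N mod 3 = 2" "?N mod 4 = 3" "odd ?N" "\<not> 3 dvd ?N" using \<open>3 dvd int n\<close> by presburger+
  have "3 * int (t 1 3 9 9 n) = 4 * chi12_cosum ?N"
    unfolding t_eq_card_odd_reps_1399 using card_odd_reps_1399_2_mod_3[OF r(1)] card_odd_reps_1311_2_mod_3[OF _ r(2,1)] by simp
  \<comment> \<open>4n + 11 is 3 modulo 4 and 2 modulo 3, so its character value is 1 and the two
    divisor sums agree.\<close>
  also have "chi12_cosum ?N = chi12_sum ?N"
    using chi12_cosum_coprime[OF _ r(3,4)] chi12_cases(4)[OF r(3,2,1)] by simp
  finally have "real_of_int (3 * int (t 1 3 9 9 n)) = real_of_int (4 * chi12_sum ?N)" by (simp only:)
  moreover have "(\<Sum>d | d dvd 4 * n + 11. real d * real_of_int (kronecker 3 (int d))) = real_of_int (chi12_sum ?N)"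
    using kronecker_divisor_sum[of "4 * n + 11"] by simp
  ultimately show "real (t 1 3 9 9 n) = 4 / 3 * (\<Sum>d | d dvd 4 * n + 11. real d * real_of_int (kronecker 3 (int d)))"
    by simp
next
  fix \<beta> n1 :: nat
  assume a: "3 dvd int n - 1 \<and> 4 * n + 11 = 3 ^ \<beta> * n1 \<and> \<not> 3 dvd n1"
  then have "3 dvd 4 * n + 11" by presburger
  then have "\<beta> \<noteq> 0" using a by (cases "\<beta> = 0") auto
  then obtain v where v: "\<beta> = Suc v" by (cases \<beta>) auto
  let ?m = "3 ^ v * int n1"
  have "int (4 * n + 11) = int (3 ^ \<beta> * n1)" using a by (simp only:)
  then have N: "4 * int n + 11 = 3 * ?m" using v by simp
  \<comment> \<open>4n + 11 is 3 modulo 4, so its third is 1 modulo 4, as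
    \<open>card_odd_reps_3133_formula\<close> requires. Only \<beta> - 1 factors 3 remain in this
    third.\<close>
  have "M mod 4 = 1" if "4 * int n + 11 = 3 * M" for M using that by presburger
  then have m4: "?m mod 4 = 1" using N .
  have "odd (3 ^ \<beta> * n1)" using a by (metis even_add even_mult_iff even_numeral odd_numeral)
  then have odd: "odd n1" by simp
  have n3: "\<not> 3 dvd int n1" using a by presburger
  have "int (t 1 3 9 9 n) = int (card (odd_reps_3133 ?m))" unfolding t_eq_card_odd_reps_1399 N card_odd_reps_1399_multiple_of_3 ..
  also have "\<dots> = 2 * (3 ^ v * chi12 (int n1) - 1) * chi12_sum (int n1)"
    by (rule card_odd_reps_3133_formula) (use n3 m4 odd odd_pos in auto)
  finally have "real_of_int (int (t 1 3 9 9 n)) = real_of_int (2 * (3 ^ v * chi12 (int n1) - 1) * chi12_sum (int n1))" by (simp only:)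
  then show "real (t 1 3 9 9 n) =
              2 * (3 powi (int \<beta> - 1) * real_of_int (kronecker 3 (int n1)) - 1) *
              (\<Sum>d | d dvd n1. real d * real_of_int (kronecker 3 (int d)))"
    using kronecker_3[of "int n1"] odd odd_pos[OF odd] kronecker_divisor_sum[OF odd] v by simp
qed

end
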